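(* Let $n\ge 3$ and let $u\in\mathcal A$. Then there exist $\bar x\in\mathbb R^n$ and constants $a>0$ and $b\ge 0$ such that $$u(x)= \left(\frac{a}{1+b|x-\bar x|^2}\right)^{\frac{n-2}{2}}\qquad\text{for all } x\in\mathbb R^n .$$
   Context: For $x\in\mathbb R^n$, $\lambda>0$ and a function $u$, the Kelvin transformation of $u$ with respect to the ball $B_\lambda(x)$ is $$u_{x,\lambda}(y):=\frac{\lambda^{n-2}}{|y-x|^{n-2}}\,u\!\left(x+\frac{\lambda^2(y-x)}{|y-x|^2}\right).$$ $\mathcal A$ denotes the set of functions $u$ on $\mathbb R^n$ with the following two properties: (A1) $u\in C^1(\mathbb R^n)$, $u>0$ in $\mathbb R^n$, and $\Delta u\le 0$ in $\mathbb R^n$ in the distribution sense. (A2) There exists some $\bar\delta>0$ such that for all $0<\delta<\bar\delta$, all $x\in\mathbb R^n$, all $\lambda>0$, and all bounded open subsets $\Omega$ of $\{y\in\mathbb R^n : |y-x|>\lambda\}$: if $(1+\delta)u\ge u_{x,\lambda}$ in $\Omega$ and $(1+\delta)u>u_{x,\lambda}$ on $\partial\Omega$, then $(1+\delta)u>u_{x,\lambda}$ in $\Omega$. *)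

theory Defs
  imports "HOL-Analysis.Analysis"
begin

definition partial_derivative :: "'n::finite \<Rightarrow> (real^'n \<Rightarrow> real) \<Rightarrow> real^'n \<Rightarrow> real" where
  "partial_derivative i f x = frechet_derivative f (at x) (axis i 1)"

text \<open>\<open>Ck k f\<close> says that \<open>f\<close> is of class \<open>C\<^sup>k\<close> on the whole space. Requiring Frechet
  differentiability (rather than mere existence of partial derivatives) makes
  \<^const>\<open>frechet_derivative\<close> meaningful; for continuous partial derivatives the two agree.\<close>

primrec Ck :: "nat \<Rightarrow> (real^'n::finite \<Rightarrow> real) \<Rightarrow> bool" where
  "Ck 0 f \<longleftrightarrow> continuous_on UNIV f"
| "Ck (Suc k) f \<longleftrightarrow> f differentiable_on UNIV \<and> (\<forall>i. Ck k (partial_derivative i f))"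

definition test_function :: "(real^'n::finite \<Rightarrow> real) \<Rightarrow> bool" where
  "test_function \<phi> \<longleftrightarrow> (\<forall>k. Ck k \<phi>) \<and> compact (closure {x. \<phi> x \<noteq> 0})"

definition laplacian :: "(real^'n::finite \<Rightarrow> real) \<Rightarrow> real^'n \<Rightarrow> real" where
  "laplacian f x = (\<Sum>i\<in>UNIV. partial_derivative i (partial_derivative i f) x)"

text \<open>\<open>\<Delta> u \<le> 0\<close> in the sense of distributions. The integrand is integrable whenever \<open>u\<close> is
  locally integrable, in particular for the continuous \<open>u\<close> considered below.\<close>

definition distr_superharmonic :: "(real^'n::finite \<Rightarrow> real) \<Rightarrow> bool" where
  "distr_superharmonic u \<longleftrightarrow>
     (\<forall>\<phi>. test_function \<phi> \<longrightarrow> (\<forall>x. \<phi> x \<ge> 0) \<longrightarrow> (LINT x|lborel. u x * laplacian \<phi> x) \<le> 0)"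

text \<open>The exponent \<open>n - 2\<close> is a subtraction of natural numbers, so \<open>n \<ge> 2\<close> is needed for it to
  be the intended one. At \<open>y = x\<close>, where the transform is undefined, the formula evaluates to \<open>0\<close>;
  only points with \<open>|y - x| \<ge> lam > 0\<close> matter below.\<close>

definition kelvin :: "(real^'n::finite \<Rightarrow> real) \<Rightarrow> real^'n \<Rightarrow> real \<Rightarrow> real^'n \<Rightarrow> real" where
  "kelvin u x lam y =
     lam ^ (CARD('n) - 2) / norm (y - x) ^ (CARD('n) - 2) *
     u (x + (lam\<^sup>2 / (norm (y - x))\<^sup>2) *\<^sub>R (y - x))"

definition property_A1 :: "(real^'n::finite \<Rightarrow> real) \<Rightarrow> bool" where
  "property_A1 u \<longleftrightarrow> Ck 1 u \<and> (\<forall>x. u x > 0) \<and> distr_superharmonic u"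

definition property_A2 :: "(real^'n::finite \<Rightarrow> real) \<Rightarrow> bool" where
  "property_A2 u \<longleftrightarrow>
     (\<exists>\<delta>0>0. \<forall>\<delta> x lam \<Omega>.
        0 < \<delta> \<longrightarrow> \<delta> < \<delta>0 \<longrightarrow> lam > 0 \<longrightarrow>
        open \<Omega> \<longrightarrow> bounded \<Omega> \<longrightarrow> \<Omega> \<subseteq> {y. norm (y - x) > lam} \<longrightarrow>
        (\<forall>y\<in>\<Omega>. (1 + \<delta>) * u y \<ge> kelvin u x lam y) \<longrightarrow>
        (\<forall>y\<in>frontier \<Omega>. (1 + \<delta>) * u y > kelvin u x lam y) \<longrightarrow>
        (\<forall>y\<in>\<Omega>. (1 + \<delta>) * u y > kelvin u x lam y))"

definition class_A :: "(real^'n::finite \<Rightarrow> real) set" where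
  "class_A = {u. property_A1 u \<and> property_A2 u}"

end

theory Submission
  imports Defs
begin

text \<open>
  The proof is the method of moving spheres. Write \<open>\<nu> = n - 2\<close> and let \<open>\<alpha>\<close>, possibly infinite, be
  the lower limit of \<open>|y| ^ \<nu> * u y\<close> at infinity. It is positive, because a positive superharmonic
  function dominates a multiple of the fundamental solution (\<open>superharmonic_lower_bound\<close>).

  Fix a centre \<open>x\<close> and a small \<open>\<delta> > 0\<close>. For small radii, \<open>(1 + \<delta>) * u\<close> lies above the Kelvin
  transform of \<open>u\<close> outside the sphere. As the radius grows, first contact cannot occur at a finite
  point, by property (A2), nor at infinity as long as \<open>lam ^ \<nu> * u x < \<alpha>\<close> (\<open>moving_spheres\<close>). Letting
  \<open>\<delta>\<close> tend to \<open>0\<close>, \<open>u\<close> lies above its transform for all such radii.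

  If \<open>\<alpha>\<close> is infinite, all spheres are admissible; large spheres approximate hyperplanes, and \<open>u\<close>
  is constant (\<open>constant_if_all_kelvin_le\<close>).

  If \<open>\<alpha>\<close> is finite, the critical radius at \<open>x\<close> is given by \<open>lam x ^ \<nu> * u x = \<alpha>\<close>, and the transform
  with this radius lies below \<open>u\<close>. Inverted at the unit sphere, all these transforms extend
  differentiably to the origin with the common value \<open>\<alpha>\<close>, which is the lower limit of the inverted
  superharmonic function that lies above them. Two of them with different gradients at the origin
  would push this limit above \<open>\<alpha>\<close> (\<open>distinct_gradients_raise_limit\<close>), so the gradient does not
  depend on \<open>x\<close>. By \<open>kelvin_expansion\<close> it is
  \<open>lam x ^ \<nu> * (\<nu> * u x * x + (lam x)\<^sup>2 * \<nabla>u x)\<close>; that this is constant is a first-order equation for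
  \<open>u\<close>, whose solutions are the stated profiles (\<open>profile_of_gradient\<close>).

  Superharmonicity enters only through comparison with harmonic functions outside a ball
  (\<open>exterior_comparison\<close>). It is extracted from the distributional inequality by testing with the
  bumps \<open>exp (- 1 / (1 - |y - c|\<^sup>2 / s\<^sup>2))\<close>: their Laplacians are, up to positive factors, the
  derivatives in \<open>s\<close> of a radial mollifier of radius \<open>s\<close>, so that the mollified values of \<open>u\<close> at \<open>c\<close>
  do not increase with \<open>s\<close>.
\<close>

section \<open>Smooth radial bumps\<close>

text \<open>The factor \<open>(1 / t) ^ m\<close> makes the family closed, up to linear combinations, under
  differentiation: this is what allows smoothness to be proved by induction.\<close>
definition exp_bump :: "nat \<Rightarrow> real \<Rightarrow> real" where
  "exp_bump m t = (if t > 0 then (1 / t) ^ m * exp (- (1 / t)) else 0)"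

lemma exp_bump_nonneg: "exp_bump m t \<ge> 0"
  by (simp add: exp_bump_def)

lemma exp_bump_pos: "t > 0 \<Longrightarrow> exp_bump m t > 0"
  by (simp add: exp_bump_def)

lemma exp_bump_eq_0: "t \<le> 0 \<Longrightarrow> exp_bump m t = 0"
  by (simp add: exp_bump_def)

text \<open>Only the order \<open>t\<^sup>2\<close> matters: it gives \<open>exp_bump m\<close> the derivative \<open>0\<close> at the
  origin, which is the one point where the two branches meet.\<close>
lemma exp_bump_le_square: "exp_bump m t \<le> real (m + 2) ^ (m + 2) * t\<^sup>2"
proof (cases "t > 0")
  case True
  define x where "x = 1 / t"
  have x: "x > 0" using True by (simp add: x_def)
  define k where "k = m + 2"
  have k: "k > 0" by (simp add: k_def)
  \<comment> \<open>with \<open>x = 1 / t\<close>, the claim is \<open>x ^ k \<le> k ^ k * exp x\<close> for \<open>k = m + 2\<close>\<close>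
  have "(x / real k) ^ k \<le> (1 + x / real k) ^ k"
    using x by (intro power_mono) auto
  also have "\<dots> \<le> exp x"
    using x k by (intro exp_ge_one_plus_x_over_n_power_n) auto
  finally have "x ^ k \<le> real k ^ k * exp x"
    using k by (simp add: power_divide field_simps)
  then have "x ^ k * exp (- x) \<le> real k ^ k"
    by (simp add: exp_minus field_simps)
  moreover have "exp_bump m t = x ^ k * exp (- x) * t\<^sup>2"
    using True by (simp add: exp_bump_def x_def k_def power_add field_simps power2_eq_square)
  ultimately show ?thesis
    by (simp add: k_def mult_right_mono)
qed (simp add: exp_bump_def)

lemma exp_bump_has_derivative:
  "(exp_bump m has_real_derivative (exp_bump (m + 2) t - real m * exp_bump (m + 1) t)) (at t)"
proof -
  consider "t > 0" | "t < 0" | "t = 0" by linarith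
  then show ?thesis
  proof cases
    case 1
    have outer: "((\<lambda>x. x ^ m * exp (- x)) has_real_derivative
        (real m * x ^ (m - 1) * exp (- x) - x ^ m * exp (- x))) (at x)" for x
      by (auto intro!: derivative_eq_intros simp: algebra_simps)
    have inner: "((\<lambda>t. 1 / t) has_real_derivative - ((1 / t)\<^sup>2)) (at t)"
      using 1 by (auto intro!: derivative_eq_intros simp: power2_eq_square)
    have "((\<lambda>t. (1 / t) ^ m * exp (- (1 / t))) has_real_derivative
        (exp_bump (m + 2) t - real m * exp_bump (m + 1) t)) (at t)"
      by (rule back_subst[of "\<lambda>d. (_ has_real_derivative d) _", OF DERIV_chain2[OF outer inner]])
        (use 1 in \<open>cases m; simp add: exp_bump_def power2_eq_square algebra_simps add_divide_distrib\<close>)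
    then show ?thesis
      by (rule has_field_derivative_transform_within_open[where S = "{0<..}"])
        (use 1 in \<open>auto simp: exp_bump_def\<close>)
  next
    case 2
    have "((\<lambda>t. 0) has_real_derivative (exp_bump (m + 2) t - real m * exp_bump (m + 1) t)) (at t)"
      using 2 by (simp add: exp_bump_def)
    then show ?thesis
      by (rule has_field_derivative_transform_within_open[where S = "{..<0}"])
        (use 2 in \<open>auto simp: exp_bump_def\<close>)
  next
    case 3
    define C where "C = real (m + 2) ^ (m + 2)"
    have "((\<lambda>h. (exp_bump m (0 + h) - exp_bump m 0) / h) \<longlongrightarrow> 0) (at 0)"
    proof (rule Lim_null_comparison)
      show "((\<lambda>h. C * \<bar>h\<bar>) \<longlongrightarrow> 0) (at (0::real))"
        by (auto intro!: tendsto_eq_intros)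
      show "\<forall>\<^sub>F h in at 0. norm ((exp_bump m (0 + h) - exp_bump m 0) / h) \<le> C * \<bar>h\<bar>"
      proof (rule eventually_at_topological[THEN iffD2], intro exI[of _ UNIV] conjI ballI impI)
        fix h :: real assume "h \<noteq> 0"
        then show "norm ((exp_bump m (0 + h) - exp_bump m 0) / h) \<le> C * \<bar>h\<bar>"
          using exp_bump_le_square[of m h] exp_bump_nonneg[of m h]
          by (simp add: exp_bump_eq_0 C_def divide_le_eq power2_eq_square mult.assoc)
      qed auto
    qed
    then show ?thesis
      using 3 by (simp add: DERIV_def exp_bump_eq_0)
  qed
qed

lemma continuous_on_exp_bump [continuous_intros]:
  "continuous_on S f \<Longrightarrow> continuous_on S (\<lambda>x. exp_bump m (f x))"
proof -
  assume f: "continuous_on S f"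
  have "continuous_on UNIV (exp_bump m)"
    by (intro continuous_at_imp_continuous_on ballI DERIV_isCont[OF exp_bump_has_derivative])
  from continuous_on_compose2[OF this f] show ?thesis by simp
qed

lemmas exp_bump_DERIV [derivative_intros] = DERIV_chain2[OF exp_bump_has_derivative]

text \<open>A class of functions that contains the radial bumps and all their partial derivatives. Since
  it is closed under partial differentiation, each member is of class \<open>Ck k\<close> for every \<open>k\<close>.\<close>
inductive bump_span :: "real^'n::finite \<Rightarrow> real \<Rightarrow> (real^'n \<Rightarrow> real) \<Rightarrow> bool" for c s where
  base: "bump_span c s (\<lambda>y. exp_bump m (1 - (norm (y - c))\<^sup>2 / s\<^sup>2))"
| scale: "bump_span c s f \<Longrightarrow> bump_span c s (\<lambda>y. a * f y)"
| add: "bump_span c s f \<Longrightarrow> bump_span c s g \<Longrightarrow> bump_span c s (\<lambda>y. f y + g y)"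
| coord: "bump_span c s f \<Longrightarrow> bump_span c s (\<lambda>y. (y $ i - c $ i) * f y)"

text \<open>\<open>f\<close> has the Frechet derivative \<open>h \<mapsto> v \<bullet> h\<close> at \<open>x\<close>; the vector form keeps second
  derivatives, which are gradients of components of gradients, easy to write down.\<close>
definition has_gradient :: "(real^'n::finite \<Rightarrow> real) \<Rightarrow> real^'n \<Rightarrow> real^'n \<Rightarrow> bool" where
  "has_gradient f v x \<longleftrightarrow> (f has_derivative (\<lambda>h. v \<bullet> h)) (at x)"

lemma has_gradient_partial: "has_gradient f v x \<Longrightarrow> partial_derivative i f x = v $ i"
  unfolding has_gradient_def partial_derivative_def
  by (drule frechet_derivative_at) (metis inner_axis inner_real_def mult.right_neutral)

lemma has_gradient_differentiable: "has_gradient f v x \<Longrightarrow> f differentiable (at x)"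
  unfolding has_gradient_def differentiable_def by blast

lemma has_gradient_add: "has_gradient f v x \<Longrightarrow> has_gradient g w x \<Longrightarrow> has_gradient (\<lambda>y. f y + g y) (v + w) x"
  unfolding has_gradient_def by (auto intro!: derivative_eq_intros simp: inner_add_left)

lemma has_gradient_mult: "has_gradient f v x \<Longrightarrow> has_gradient g w x \<Longrightarrow>
    has_gradient (\<lambda>y. f y * g y) (f x *\<^sub>R w + g x *\<^sub>R v) x"
  unfolding has_gradient_def by (auto intro!: derivative_eq_intros simp: inner_add_left algebra_simps)

lemma has_gradient_const: "has_gradient (\<lambda>y. a) 0 x"
  unfolding has_gradient_def by (auto intro!: derivative_eq_intros)

lemma has_gradient_coord: "has_gradient (\<lambda>y. y $ i - b) (axis i 1) x"
  unfolding has_gradient_def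
  by (auto intro!: derivative_eq_intros bounded_linear_imp_has_derivative bounded_linear_vec_nth
      simp: inner_axis')

lemma has_gradient_norm_square: "has_gradient (\<lambda>y. (norm (y - c))\<^sup>2) (2 *\<^sub>R (x - c)) x"
  unfolding has_gradient_def power2_norm_eq_inner
  by (auto intro!: derivative_eq_intros simp: inner_commute)

lemma has_gradient_compose: 
  assumes "(g has_real_derivative d) (at (f x))" "has_gradient f v x"
  shows "has_gradient (\<lambda>y. g (f y)) (d *\<^sub>R v) x"
  using has_derivative_compose[OF assms(2)[unfolded has_gradient_def], of g "\<lambda>h. d * h"] assms(1)
  unfolding has_gradient_def has_field_derivative_def inner_scaleR_left by blast

lemma has_gradient_bump:
  "has_gradient (\<lambda>y. exp_bump m (1 - (norm (y - c))\<^sup>2 / s\<^sup>2))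
     ((- 2 / s\<^sup>2 * (exp_bump (m + 2) (1 - (norm (x - c))\<^sup>2 / s\<^sup>2) - real m * exp_bump (m + 1) (1 - (norm (x - c))\<^sup>2 / s\<^sup>2)))
        *\<^sub>R (x - c)) x"
proof -
  have "((\<lambda>t. exp_bump m (1 - t / s\<^sup>2)) has_real_derivative
      (exp_bump (m + 2) (1 - t / s\<^sup>2) - real m * exp_bump (m + 1) (1 - t / s\<^sup>2)) * (0 - 1 / s\<^sup>2)) (at t)" for t
    by (intro exp_bump_DERIV DERIV_diff DERIV_const DERIV_cdivide DERIV_ident)
  from has_gradient_compose[OF this has_gradient_norm_square[of c x]]
  show ?thesis by (simp add: mult.commute)
qed

text \<open>The chain rule applied to \<open>exp_bump m\<close> produces the factor \<open>y $ i - c $ i\<close> and bumps of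
  orders \<open>m + 1\<close> and \<open>m + 2\<close>, all of which \<open>bump_span\<close> allows.\<close>
lemma bump_span_has_gradient:
  assumes "bump_span c s f"
  shows "\<exists>D. (\<forall>i. bump_span c s (\<lambda>y. D y $ i)) \<and> (\<forall>x. has_gradient f (D x) x)"
  using assms
proof induction
  case (base m)
  have "bump_span c s (\<lambda>y. (y $ i - c $ i) * ((- 2 / s\<^sup>2) * (exp_bump (m + 2) (1 - (norm (y - c))\<^sup>2 / s\<^sup>2)
       + (- real m) * exp_bump (m + 1) (1 - (norm (y - c))\<^sup>2 / s\<^sup>2))))" for i
    by (intro bump_span.intros)
  then show ?case
    by (intro exI[of _ "\<lambda>x. (- 2 / s\<^sup>2 * (exp_bump (m + 2) (1 - (norm (x - c))\<^sup>2 / s\<^sup>2)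
         - real m * exp_bump (m + 1) (1 - (norm (x - c))\<^sup>2 / s\<^sup>2))) *\<^sub>R (x - c)"] conjI allI has_gradient_bump)
      (simp add: mult_ac)
next
  case (scale f a)
  then obtain D where D: "\<forall>i. bump_span c s (\<lambda>y. D y $ i)" "\<forall>x. has_gradient f (D x) x"
    by blast
  have "has_gradient (\<lambda>y. a * f y) (a *\<^sub>R D x) x" for x
    using has_gradient_mult[OF has_gradient_const D(2)[rule_format]] by simp
  then show ?case using D(1)
    by (intro exI[of _ "\<lambda>x. a *\<^sub>R D x"]) (auto intro: bump_span.intros)
next
  case (add f g)
  then obtain D E where D: "\<forall>i. bump_span c s (\<lambda>y. D y $ i)" "\<forall>x. has_gradient f (D x) x"
    and E: "\<forall>i. bump_span c s (\<lambda>y. E y $ i)" "\<forall>x. has_gradient g (E x) x"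
    by blast
  then show ?case
    by (intro exI[of _ "\<lambda>x. D x + E x"]) (auto intro: bump_span.intros has_gradient_add)
next
  case (coord f i)
  then obtain D where D: "\<forall>i. bump_span c s (\<lambda>y. D y $ i)" "\<forall>x. has_gradient f (D x) x"
    by blast
  have "has_gradient (\<lambda>y. (y $ i - c $ i) * f y) ((x $ i - c $ i) *\<^sub>R D x + f x *\<^sub>R axis i 1) x" for x
    by (rule has_gradient_mult[OF has_gradient_coord D(2)[rule_format]])
  moreover have "bump_span c s (\<lambda>y. (y $ i - c $ i) * D y $ j + (axis i 1 $ j) * f y)" for j
    using D(1) coord(1) by (intro bump_span.intros) auto
  ultimately show ?case
    by (intro exI[of _ "\<lambda>x. (x $ i - c $ i) *\<^sub>R D x + f x *\<^sub>R axis i 1"]) (simp add: mult.commute)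
qed

lemma bump_span_Ck: "bump_span c s f \<Longrightarrow> Ck k f"
proof (induction k arbitrary: f)
  case 0
  then obtain D where "\<forall>x. has_gradient f (D x) x"
    using bump_span_has_gradient by blast
  then show ?case
    by (auto intro!: continuous_at_imp_continuous_on differentiable_imp_continuous_within
        has_gradient_differentiable)
next
  case (Suc k)
  then obtain D where D: "\<forall>i. bump_span c s (\<lambda>y. D y $ i)" "\<forall>x. has_gradient f (D x) x"
    using bump_span_has_gradient by blast
  have "partial_derivative i f = (\<lambda>y. D y $ i)" for i
    using D(2) has_gradient_partial by blast
  then show ?case
    using D Suc.IH by (auto simp: differentiable_on_def intro: has_gradient_differentiable)
qed

definition bump :: "real^'n::finite \<Rightarrow> real \<Rightarrow> real^'n \<Rightarrow> real" where
  "bump c s y = exp_bump 0 (1 - (norm (y - c))\<^sup>2 / s\<^sup>2)"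

lemma bump_arg_nonpos_iff: "s > 0 \<Longrightarrow> 1 - (norm (y - c))\<^sup>2 / s\<^sup>2 \<le> 0 \<longleftrightarrow> s \<le> norm (y - c)"
  using power_mono_iff[of s "norm (y - c)" 2] by (simp add: field_simps)

lemma bump_test_function:
  assumes "s > 0"
  shows "test_function (bump c s)"
  unfolding test_function_def
proof
  show "\<forall>k. Ck k (bump c s)"
    unfolding bump_def[abs_def] by (intro allI bump_span_Ck[of c s] bump_span.base)
  have "{x. bump c s x \<noteq> 0} \<subseteq> cball c s"
  proof
    fix x assume "x \<in> {x. bump c s x \<noteq> 0}"
    then have "\<not> (1 - (norm (x - c))\<^sup>2 / s\<^sup>2 \<le> 0)"
      using exp_bump_eq_0 by (auto simp: bump_def)
    then show "x \<in> cball c s"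
      using assms by (simp only: bump_arg_nonpos_iff) (simp add: dist_norm norm_minus_commute)
  qed
  then show "compact (closure {x. bump c s x \<noteq> 0})"
    using compact_closure bounded_subset bounded_cball by blast
qed

lemma bump_gradient:
  "has_gradient (bump c s) ((- 2 / s\<^sup>2 * exp_bump 2 (1 - (norm (x - c))\<^sup>2 / s\<^sup>2)) *\<^sub>R (x - c)) x"
  using has_gradient_bump[of 0 c s x] by (simp add: bump_def[abs_def] numeral_2_eq_2)

lemma partial_bump:
  "partial_derivative i (bump c s) y = - 2 / s\<^sup>2 * exp_bump 2 (1 - (norm (y - c))\<^sup>2 / s\<^sup>2) * (y $ i - c $ i)"
  using has_gradient_partial[OF bump_gradient[of c s y]] by simp

lemma partial_bump_gradient:
  "has_gradient (partial_derivative i (bump c s))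
    ((- 2 / s\<^sup>2 * (- 2 / s\<^sup>2 * (exp_bump 4 (1 - (norm (x - c))\<^sup>2 / s\<^sup>2) - 2 * exp_bump 3 (1 - (norm (x - c))\<^sup>2 / s\<^sup>2)))
        * (x $ i - c $ i)) *\<^sub>R (x - c) 
     + (- 2 / s\<^sup>2 * exp_bump 2 (1 - (norm (x - c))\<^sup>2 / s\<^sup>2)) *\<^sub>R axis i 1) x"
proof -
  have eq: "partial_derivative i (bump c s) = 
     (\<lambda>y. - 2 / s\<^sup>2 * exp_bump 2 (1 - (norm (y - c))\<^sup>2 / s\<^sup>2) * (y $ i - c $ i))"
    using partial_bump by blast
  note g = has_gradient_mult[OF has_gradient_mult[OF has_gradient_const[of "- 2 / s\<^sup>2"] has_gradient_bump[of 2]] has_gradient_coord]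
  show ?thesis unfolding eq
    by (rule back_subst[of "\<lambda>v. has_gradient _ v _", OF g]) (simp add: eval_nat_numeral mult_ac)
qed

lemma laplacian_bump:
  fixes c :: "real^'n::finite"
  shows "laplacian (bump c s) y = - (2 * real CARD('n) / s\<^sup>2) * exp_bump 2 (1 - (norm (y - c))\<^sup>2 / s\<^sup>2)
     + 4 * (norm (y - c))\<^sup>2 / s ^ 4 * (exp_bump 4 (1 - (norm (y - c))\<^sup>2 / s\<^sup>2) - 2 * exp_bump 3 (1 - (norm (y - c))\<^sup>2 / s\<^sup>2))"
proof -
  define A where "A = exp_bump 4 (1 - (norm (y - c))\<^sup>2 / s\<^sup>2) - 2 * exp_bump 3 (1 - (norm (y - c))\<^sup>2 / s\<^sup>2)"
  have "partial_derivative i (partial_derivative i (bump c s)) y =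
     4 / s ^ 4 * A * (y $ i - c $ i)\<^sup>2 - 2 / s\<^sup>2 * exp_bump 2 (1 - (norm (y - c))\<^sup>2 / s\<^sup>2)" for i
    using has_gradient_partial[OF partial_bump_gradient[of i c s y], of i]
    by (simp add: A_def power2_eq_square power4_eq_xxxx axis_def)
  moreover have "(\<Sum>i\<in>UNIV. 4 / s ^ 4 * A * (y $ i - c $ i)\<^sup>2) = 4 / s ^ 4 * A * (\<Sum>i\<in>UNIV. (y $ i - c $ i)\<^sup>2)"
    by (rule sum_distrib_left[symmetric])
  moreover have "(\<Sum>i\<in>UNIV. (y $ i - c $ i)\<^sup>2) = (norm (y - c))\<^sup>2"
    by (simp add: power2_norm_eq_inner inner_vec_def) (simp add: power2_eq_square)
  ultimately show ?thesis
    unfolding laplacian_def A_def[symmetric]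
    by (simp only: sum_subtractf sum_constant) (simp add: mult_ac)
qed

section \<open>Averages against a radial mollifier\<close>

text \<open>A radial mollifier of radius \<open>s\<close>, whose mass does not depend on \<open>s\<close>. It is tied to \<open>bump\<close>:
  up to a positive factor, its derivative in \<open>s\<close> is the Laplacian of the nonnegative test function
  \<open>bump c s\<close>. Testing superharmonicity against these bumps therefore says that the
  averages of \<open>u\<close> against \<open>bump_kernel c s\<close> do not increase with \<open>s\<close>.\<close>
definition bump_kernel :: "real^'n::finite \<Rightarrow> real \<Rightarrow> real^'n \<Rightarrow> real" where
  "bump_kernel c s y = exp_bump 2 (1 - (norm (y - c))\<^sup>2 / s\<^sup>2) / s ^ CARD('n)"

lemma bump_kernel_nonneg: "s > 0 \<Longrightarrow> bump_kernel c s y \<ge> 0"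
  by (simp add: bump_kernel_def exp_bump_nonneg)

lemma bump_kernel_pos: "s > 0 \<Longrightarrow> y \<in> ball c s \<Longrightarrow> bump_kernel c s y > 0"
  using bump_arg_nonpos_iff[of s y c] exp_bump_pos[of "1 - (norm (y - c))\<^sup>2 / s\<^sup>2" 2]
  by (simp only: bump_kernel_def mem_ball dist_norm norm_minus_commute[of c] not_le[symmetric] not_False_eq_True)
    (simp add: not_le)

lemma bump_kernel_eq_0: "s > 0 \<Longrightarrow> y \<notin> ball c s \<Longrightarrow> bump_kernel c s y = 0"
  using bump_arg_nonpos_iff[of s y c]
  by (simp add: bump_kernel_def exp_bump_eq_0 dist_norm norm_minus_commute)

text \<open>With \<open>z = (y - c) / s\<close>, the kernel is \<open>s ^ (- n) * k z\<close>, and its derivative in \<open>s\<close> is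
  \<open>- s ^ (- n - 1)\<close> times the divergence of \<open>z * k z\<close>. For radial \<open>k\<close> this field is a gradient,
  here a multiple of that of the bump.\<close>
lemma bump_kernel_has_derivative:
  fixes c y :: "real^'n::finite"
  assumes "s > 0"
  shows "((\<lambda>s. bump_kernel c s y) has_real_derivative s / (2 * s ^ CARD('n)) * laplacian (bump c s) y) (at s)"
proof -
  define q where "q = (norm (y - c))\<^sup>2"
  have inner: "((\<lambda>s. 1 - q / s\<^sup>2) has_real_derivative 2 * q / s ^ 3) (at s)"
    using assms by (auto intro!: derivative_eq_intros simp: field_simps power2_eq_square power3_eq_cube)
  \<comment> \<open>the power rule yields the exponent \<open>n - 1\<close> as a truncated difference\<close>
  obtain m where m: "CARD('n) = Suc m"
    using zero_less_card_finite[where 'a='n] gr0_implies_Suc by blast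
  show ?thesis
    unfolding bump_kernel_def laplacian_bump q_def[symmetric]
    by (rule back_subst[of "\<lambda>d. (_ has_real_derivative d) _",
          OF DERIV_divide[OF exp_bump_DERIV[OF inner] DERIV_pow]])
      (use assms in \<open>simp_all add: m field_simps power2_eq_square eval_nat_numeral\<close>)
qed

lemma continuous_on_laplacian_bump: "continuous_on S (laplacian (bump c s))"
  unfolding laplacian_bump[abs_def] divide_inverse by (intro continuous_intros)

lemma laplacian_bump_eq_0:
  "s > 0 \<Longrightarrow> y \<notin> ball c s \<Longrightarrow> laplacian (bump c s) y = 0"
  using bump_arg_nonpos_iff[of s y c]
  by (simp add: laplacian_bump exp_bump_eq_0 dist_norm norm_minus_commute)

lemma continuous_on_bump_kernel: "continuous_on S (bump_kernel c s)"
  unfolding bump_kernel_def[abs_def] divide_inverse by (intro continuous_intros)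

lemma mollification_has_derivative:
  fixes c :: "real^'n::finite"
  assumes "s > 0" and w: "continuous_on (cbox a b) w"
  shows "((\<lambda>s. integral (cbox a b) (\<lambda>y. w y * bump_kernel c s y)) has_real_derivative
     s / (2 * s ^ CARD('n)) * integral (cbox a b) (\<lambda>y. w y * laplacian (bump c s) y)) (at s)"
proof -
  have "((\<lambda>s. integral (cbox a b) (\<lambda>y. w y * bump_kernel c s y)) has_real_derivative
     integral (cbox a b) (\<lambda>y. w y * (s / (2 * s ^ CARD('n)) * laplacian (bump c s) y))) (at s within {0<..})"
  proof (rule leibniz_rule_field_derivative)
    fix r :: real and y :: "real^'n" assume "r \<in> {0<..}"
    then show "((\<lambda>s. w y * bump_kernel c s y) has_real_derivative w y * (r / (2 * r ^ CARD('n)) * laplacian (bump c r) y))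
       (at r within {0<..})"
      by (intro DERIV_cmult has_field_derivative_at_within[OF bump_kernel_has_derivative]) auto
  next
    fix r :: real assume "r \<in> {0<..}"
    show "(\<lambda>y. w y * bump_kernel c r y) integrable_on cbox a b"
      by (intro integrable_continuous continuous_intros w continuous_on_bump_kernel)
  next
    have "continuous_on ({0<..} \<times> cbox a b) (\<lambda>p. w (snd p) * (fst p / (2 * fst p ^ CARD('n)) * laplacian (bump c (fst p)) (snd p)))"
      unfolding laplacian_bump
      by (intro continuous_intros continuous_on_compose2[OF w]) auto
    then show "continuous_on ({0<..} \<times> cbox a b) (\<lambda>(s, y). w y * (s / (2 * s ^ CARD('n)) * laplacian (bump c s) y))"
      by (simp add: case_prod_beta')
  qed (use assms in auto)
  moreover have "integral (cbox a b) (\<lambda>y. w y * (s / (2 * s ^ CARD('n)) * laplacian (bump c s) y)) =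
      s / (2 * s ^ CARD('n)) * integral (cbox a b) (\<lambda>y. w y * laplacian (bump c s) y)"
    by (subst integral_mult_right[symmetric]) (rule integral_cong, simp)
  moreover have "at s within {0<..} = at s"
    using assms by (simp add: at_within_open[of _ "{0<..}"])
  ultimately show ?thesis by (simp only:)
qed

lemma
  fixes f :: "'a::euclidean_space \<Rightarrow> real"
  assumes "continuous_on (cbox a b) f" and "\<And>y. y \<notin> cbox a b \<Longrightarrow> f y = 0"
  shows integrable_supported_cbox: "integrable lborel f"
    and LINT_supported_cbox: "(LINT y|lborel. f y) = integral (cbox a b) f"
proof -
  have eq: "f = (\<lambda>x. indicator (cbox a b) x *\<^sub>R f x)"
    using assms(2) by (auto simp: indicator_def fun_eq_iff)
  show int: "integrable lborel f"
    by (subst eq, rule borel_integrable_compact) (use assms in auto)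
  have "(LINT y|lborel. f y) = integral UNIV f"
    by (rule integral_lborel[OF int, symmetric])
  also have "\<dots> = integral UNIV (\<lambda>x. if x \<in> cbox a b then f x else 0)"
    using assms(2) by (metis (full_types))
  also have "\<dots> = integral (cbox a b) f"
    by (rule integral_restrict_UNIV)
  finally show "(LINT y|lborel. f y) = integral (cbox a b) f" .
qed

lemma LINT_lborel_translation:
  fixes f :: "'a::euclidean_space \<Rightarrow> real"
  assumes "f \<in> borel_measurable borel"
  shows "(LINT y|lborel. f (c + y)) = (LINT y|lborel. f y)"
proof -
  have "(LINT y|lborel. f y) = (LINT y|distr lborel borel ((+) c). f y)"
    by (simp add: lborel_distr_plus)
  also have "\<dots> = (LINT y|lborel. f (c + y))"
    by (rule integral_distr) (use assms in auto)
  finally show ?thesis by simp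
qed

lemma cball_subset_some_cbox: "\<exists>a b. cball c r \<subseteq> cbox a (b::'a::euclidean_space)"
  using bounded_subset_cbox_symmetric[OF bounded_cball[of c r]] by metis

text \<open>The integral of the translates \<open>y \<mapsto> f (h e + y)\<close> does not depend on \<open>h\<close>; differentiating it
  under the integral sign at \<open>h = 0\<close> gives the claim.\<close>
lemma LINT_partial_eq_0:
  fixes f :: "real^'n::finite \<Rightarrow> real"
  assumes grad: "\<And>y. has_gradient f (g y) y"
    and cont: "continuous_on UNIV (\<lambda>y. g y $ i)"
    and supp: "\<And>y. y \<notin> cball c s \<Longrightarrow> f y = 0"
  shows "(LINT y|lborel. g y $ i) = 0"
proof -
  obtain a b where ab: "cball c (s + 1) \<subseteq> cbox a (b::real^'n)"
    using cball_subset_some_cbox by blast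
  define e :: "real^'n" where "e = axis i 1"
  have e: "norm e = 1" by (simp add: e_def)
  have f_cont: "continuous_on UNIV f"
    using grad by (auto intro!: continuous_at_imp_continuous_on differentiable_imp_continuous_within
        has_gradient_differentiable)
  have g_supp: "g y = 0" if "y \<notin> cball c s" for y
  proof -
    have "open (- cball c s)" by auto
    then have "has_gradient f 0 y"
      using that supp unfolding has_gradient_def
      by (rule_tac has_derivative_transform_within_open[of "\<lambda>_. 0" _ _ _ "- cball c s"]) 
        (auto simp: inner_zero_left[abs_def])
    then have "g y $ j = 0" for j
      using has_gradient_partial[OF grad, of j y] has_gradient_partial[of f 0 y j] by simp
    then show ?thesis by (simp add: vec_eq_iff)
  qed
  define F where "F h = integral (cbox a b) (\<lambda>y. f (h *\<^sub>R e + y))" for h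
  \<comment> \<open>shifts by less than \<open>1\<close> keep the support inside the box, so that \<open>F h\<close> is the full integral\<close>
  have F_const: "F h = (LINT y|lborel. f y)" if "h \<in> {-1<..<1}" for h
  proof -
    have "f (h *\<^sub>R e + y) = 0" if "y \<notin> cbox a b" for y
    proof (rule supp)
      have "y \<notin> cball c (s + 1)" using that ab by blast
      moreover have "norm (h *\<^sub>R e) < 1" using \<open>h \<in> _\<close> e by (simp add: abs_less_iff)
      ultimately show "h *\<^sub>R e + y \<notin> cball c s"
        using norm_triangle_ineq4[of "h *\<^sub>R e + y - c" "h *\<^sub>R e"]
        by (simp add: dist_norm norm_minus_commute[of c])
    qed
    then have "F h = (LINT y|lborel. f (h *\<^sub>R e + y))"
      unfolding F_def
      by (intro LINT_supported_cbox[symmetric] continuous_on_compose2[OF f_cont] continuous_intros) auto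
    then show ?thesis
      using LINT_lborel_translation borel_measurable_continuous_onI[OF f_cont] by metis
  qed
  have "(F has_real_derivative integral (cbox a b) (\<lambda>y. g (0 *\<^sub>R e + y) $ i)) (at 0 within {-1<..<1})"
    unfolding F_def
  proof (rule leibniz_rule_field_derivative)
    fix h :: real and y :: "real^'n"
    have "((\<lambda>h. f (h *\<^sub>R e + y)) has_derivative (\<lambda>t. g (h *\<^sub>R e + y) \<bullet> (t *\<^sub>R e))) (at h)"
      by (rule has_derivative_compose[OF _ grad[unfolded has_gradient_def]])
        (auto intro!: derivative_eq_intros)
    moreover have "(\<lambda>t. g (h *\<^sub>R e + y) \<bullet> (t *\<^sub>R e)) = (*) (g (h *\<^sub>R e + y) $ i)"
      by (simp add: fun_eq_iff e_def inner_axis mult.commute)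
    ultimately show "((\<lambda>h. f (h *\<^sub>R e + y)) has_real_derivative g (h *\<^sub>R e + y) $ i) (at h within {-1<..<1})"
      unfolding has_field_derivative_def using has_derivative_at_withinI by metis
  next
    fix h :: real
    show "(\<lambda>y. f (h *\<^sub>R e + y)) integrable_on cbox a b"
      by (intro integrable_continuous continuous_on_compose2[OF f_cont] continuous_intros) auto
  next
    show "continuous_on ({-1<..<1} \<times> cbox a b) (\<lambda>(h, y). g (h *\<^sub>R e + y) $ i)"
      unfolding case_prod_beta'
      by (intro continuous_on_compose2[OF cont] continuous_intros) auto
  qed auto
  then have "(F has_real_derivative integral (cbox a b) (\<lambda>y. g y $ i)) (at 0)"
    by (simp add: at_within_open[of _ "{-1<..<1}"])
  moreover have "(F has_real_derivative 0) (at 0)"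
  proof (rule has_field_derivative_transform_within_open[of "\<lambda>_. LINT y|lborel. f y" _ _ "{-1<..<1}"])
    show "((\<lambda>_. LINT y|lborel. f y) has_real_derivative 0) (at 0)"
      by (rule DERIV_const)
  qed (use F_const in auto)
  ultimately have "integral (cbox a b) (\<lambda>y. g y $ i) = 0"
    by (rule DERIV_unique)
  moreover have "g y $ i = 0" if "y \<notin> cbox a b" for y
  proof -
    have "y \<notin> cball c s" using that ab subset_cball[of s "s + 1" c] by auto
    then show ?thesis by (simp add: g_supp)
  qed
  ultimately show ?thesis
    using LINT_supported_cbox[of a b "\<lambda>y. g y $ i"] continuous_on_subset[OF cont subset_UNIV] by simp
qed

section \<open>The super-mean-value inequality\<close>

text \<open>Classical harmonicity, for open \<open>U\<close>: differentiability is Frechet differentiability at the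
  points of \<open>U\<close>, so that the partial derivatives in \<open>laplacian\<close> are the true ones.\<close>
definition harmonic_on :: "(real^'n::finite) set \<Rightarrow> (real^'n \<Rightarrow> real) \<Rightarrow> bool" where
  "harmonic_on U H \<longleftrightarrow>
     (\<forall>x\<in>U. H differentiable (at x) \<and> (\<forall>i. partial_derivative i H differentiable (at x)) \<and> laplacian H x = 0) \<and>
     (\<forall>i. continuous_on U (partial_derivative i (partial_derivative i H)))"

lemma has_gradient_partials:
  assumes "f differentiable (at x)"
  shows "has_gradient f (\<chi> i. partial_derivative i f x) x"
proof -
  from assms have D: "(f has_derivative frechet_derivative f (at x)) (at x)"
    by (simp add: frechet_derivative_works)
  then interpret bounded_linear "frechet_derivative f (at x)"
    by (rule has_derivative_bounded_linear)
  have "frechet_derivative f (at x) h = (\<chi> i. partial_derivative i f x) \<bullet> h" for h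
  proof -
    have "frechet_derivative f (at x) h = frechet_derivative f (at x) (\<Sum>i\<in>UNIV. h $ i *\<^sub>R axis i 1)"
      using basis_expansion[of h] by (simp add: scalar_mult_eq_scaleR)
    also have "\<dots> = (\<Sum>i\<in>UNIV. h $ i * partial_derivative i f x)"
      by (simp add: sum scale partial_derivative_def)
    finally show ?thesis by (simp add: inner_vec_def mult.commute)
  qed
  then have "frechet_derivative f (at x) = (\<lambda>h. (\<chi> i. partial_derivative i f x) \<bullet> h)"
    by blast
  with D show ?thesis unfolding has_gradient_def by (simp only:)
qed

lemma harmonic_on_continuous: "harmonic_on U H \<Longrightarrow> continuous_on U H"
  unfolding harmonic_on_def
  by (auto intro!: continuous_at_imp_continuous_on differentiable_imp_continuous_within)

lemma has_gradient_transform: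
  assumes "has_gradient f v x" "open S" "x \<in> S" "\<And>y. y \<in> S \<Longrightarrow> f y = g y"
  shows "has_gradient g v x"
  using has_derivative_transform_within_open[OF assms(1)[unfolded has_gradient_def] assms(2,3)] assms(4)
  unfolding has_gradient_def by blast

lemma bump_eq_0: "s > 0 \<Longrightarrow> y \<notin> ball c s \<Longrightarrow> bump c s y = 0"
  and partial_bump_eq_0: "s > 0 \<Longrightarrow> y \<notin> ball c s \<Longrightarrow> partial_derivative i (bump c s) y = 0"
  using bump_arg_nonpos_iff[of s y c]
  by (simp_all add: bump_def partial_bump exp_bump_eq_0 dist_norm norm_minus_commute)

text \<open>Green's second identity: \<open>H * \<Delta>\<psi> - \<psi> * \<Delta>H\<close> is the divergence of the compactly supported
  field \<open>H * \<nabla>\<psi> - \<psi> * \<nabla>H\<close>, so it integrates to \<open>0\<close>. It is defined and smooth enough on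
  the whole space, because \<open>\<psi>\<close> vanishes near every point outside \<open>U\<close>.\<close>
lemma LINT_harmonic_laplacian_bump:
  fixes H :: "real^'n::finite \<Rightarrow> real"
  assumes H: "harmonic_on U H" and U: "open U" "cball c s \<subseteq> U" and s: "s > 0"
  shows "(LINT y|lborel. H y * laplacian (bump c s) y) = 0"
proof -
  define \<psi> where "\<psi> = bump c s"
  let ?d = "\<lambda>i f. partial_derivative i f"
  obtain a b where ab: "cball c s \<subseteq> cbox a (b::real^'n)"
    using cball_subset_some_cbox by blast
  have zero: "\<psi> y = 0" "?d i \<psi> y = 0" "?d j (?d i \<psi>) y = 0" if "y \<notin> cball c s" for y i j
  proof -
    have y: "y \<notin> ball c s" using that by auto
    show "\<psi> y = 0" "?d i \<psi> y = 0"
      using y s by (auto simp: \<psi>_def bump_eq_0 partial_bump_eq_0)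
    have "has_gradient (?d i \<psi>) 0 y"
      by (rule has_gradient_transform[OF has_gradient_const[of 0], of "- cball c s"])
        (use that s in \<open>auto simp: \<psi>_def partial_bump_eq_0\<close>)
    then show "?d j (?d i \<psi>) y = 0"
      using has_gradient_partial by force
  qed
  have cont_dd: "continuous_on UNIV (?d i (?d i \<psi>))" for i
  proof -
    have eq: "?d i (?d i \<psi>) = (\<lambda>y. 4 / s ^ 4 * (exp_bump 4 (1 - (norm (y - c))\<^sup>2 / s\<^sup>2) - 2 * exp_bump 3 (1 - (norm (y - c))\<^sup>2 / s\<^sup>2)) * (y $ i - c $ i)\<^sup>2
         - 2 / s\<^sup>2 * exp_bump 2 (1 - (norm (y - c))\<^sup>2 / s\<^sup>2))"
    proof
      fix y
      show "?d i (?d i \<psi>) y = 4 / s ^ 4 * (exp_bump 4 (1 - (norm (y - c))\<^sup>2 / s\<^sup>2) - 2 * exp_bump 3 (1 - (norm (y - c))\<^sup>2 / s\<^sup>2)) * (y $ i - c $ i)\<^sup>2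
         - 2 / s\<^sup>2 * exp_bump 2 (1 - (norm (y - c))\<^sup>2 / s\<^sup>2)"
        using has_gradient_partial[OF partial_bump_gradient[of i c s y], of i]
        by (simp add: \<psi>_def power2_eq_square power4_eq_xxxx axis_def)
    qed
    show ?thesis unfolding eq divide_inverse by (intro continuous_intros)
  qed
  have cont_psi: "continuous_on UNIV \<psi>"
    unfolding \<psi>_def bump_def[abs_def] divide_inverse by (intro continuous_intros)
  define D where "D i y = H y * ?d i (?d i \<psi>) y - \<psi> y * ?d i (?d i H) y" for i y
  have D_0: "D i y = 0" if "y \<notin> cball c s" for i y
    using zero[OF that] by (simp add: D_def)
  have D_cont: "continuous_on UNIV (D i)" for i
  proof -
    have "continuous_on U (D i)"
      unfolding D_def using H harmonic_on_continuous[OF H]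
      by (intro continuous_intros continuous_on_subset[OF cont_dd] continuous_on_subset[OF cont_psi])
        (auto simp: harmonic_on_def)
    moreover have "continuous_on (- cball c s) (D i)"
      using D_0 by (intro continuous_on_cong[THEN iffD2, OF refl _ continuous_on_const[of _ 0]]) auto
    ultimately have "continuous_on (U \<union> - cball c s) (D i)"
      using U by (intro continuous_on_open_Un) auto
    moreover have "U \<union> - cball c s = UNIV" using U by blast
    ultimately show ?thesis by simp
  qed
  have D_int: "integrable lborel (D i)" and D_LINT: "(LINT y|lborel. D i y) = 0" for i
  proof -
    show "integrable lborel (D i)"
      by (rule integrable_supported_cbox[of a b]) (use continuous_on_subset[OF D_cont subset_UNIV] ab D_0 in blast)+
    define f where "f y = H y * ?d i \<psi> y - \<psi> y * ?d i H y" for y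
    have f_0: "f y = 0" if "y \<notin> cball c s" for y
      using zero[OF that] by (simp add: f_def)
    \<comment> \<open>the product rule applies on \<open>U\<close>, and off the closed ball \<open>f\<close> vanishes identically\<close>
    have "\<exists>v. has_gradient f v y \<and> v $ i = D i y" for y
    proof (cases "y \<in> U")
      case True
      have dH: "has_gradient H (\<chi> i. ?d i H y) y" "has_gradient (?d i H) (\<chi> j. ?d j (?d i H) y) y"
        using H True by (auto simp: harmonic_on_def intro: has_gradient_partials)
      have dp: "has_gradient \<psi> (\<chi> i. ?d i \<psi> y) y" "has_gradient (?d i \<psi>) (\<chi> j. ?d j (?d i \<psi>) y) y"
        unfolding \<psi>_def
        by (auto intro!: has_gradient_partials has_gradient_differentiable[OF bump_gradient]
            has_gradient_differentiable[OF partial_bump_gradient])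
      have "has_gradient (\<lambda>y. H y * ?d i \<psi> y + (- 1) * (\<psi> y * ?d i H y))
         (H y *\<^sub>R (\<chi> j. ?d j (?d i \<psi>) y) + ?d i \<psi> y *\<^sub>R (\<chi> i. ?d i H y)
          + ((- 1) *\<^sub>R (\<psi> y *\<^sub>R (\<chi> j. ?d j (?d i H) y) + ?d i H y *\<^sub>R (\<chi> i. ?d i \<psi> y)) + (\<psi> y * ?d i H y) *\<^sub>R 0)) y"
        by (intro has_gradient_add has_gradient_mult has_gradient_const dH dp)
      then show ?thesis
        unfolding f_def[abs_def] by (intro exI conjI) (auto simp: D_def)
    next
      case False
      then have y: "y \<notin> cball c s" using U by blast
      have "has_gradient f 0 y"
        by (rule has_gradient_transform[OF has_gradient_const[of 0], of "- cball c s"])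
          (use y f_0 in auto)
      then show ?thesis using D_0[OF y] by (intro exI[of _ 0]) auto
    qed
    then obtain g where g: "\<And>y. has_gradient f (g y) y" "\<And>y. g y $ i = D i y"
      by metis
    show "(LINT y|lborel. D i y) = 0"
      using LINT_partial_eq_0[of f g i c s] g f_0 D_cont[of i] by (simp add: g(2)[abs_def])
  qed
  have "H y * laplacian (bump c s) y = (\<Sum>i\<in>UNIV. D i y)" for y
  proof (cases "y \<in> U")
    case True
    then have "laplacian H y = 0" using H by (simp add: harmonic_on_def)
    moreover have "(\<Sum>i\<in>UNIV. D i y) = H y * laplacian \<psi> y - \<psi> y * laplacian H y"
      unfolding D_def laplacian_def by (simp add: sum_subtractf sum_distrib_left)
    ultimately show ?thesis by (simp add: \<psi>_def)
  next
    case False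
    then have "y \<notin> cball c s" using U by blast
    then show ?thesis using s by (simp add: D_0 laplacian_bump_eq_0)
  qed
  then show ?thesis
    using D_int D_LINT by (simp add: Bochner_Integration.integral_sum)
qed

text \<open>Monotonicity of the averages of \<open>u - H\<close> in the radius, compared with their limit at radius
  \<open>0\<close>. The total mass \<open>K\<close> of the kernel is constant for the same reason, since the constant \<open>1\<close>
  is harmonic.\<close>
lemma supermean_inequality:
  fixes u H :: "real^'n::finite \<Rightarrow> real"
  assumes u: "distr_superharmonic u" "continuous_on UNIV u"
    and H: "harmonic_on U H" "open U" 
    and sub: "cball c r \<subseteq> cbox a b" "cbox a b \<subseteq> U" and r: "r > 0"
  shows "integral (cbox a b) (\<lambda>y. (u y - H y) * bump_kernel c r y)
     \<le> (u c - H c) * integral (cbox a b) (bump_kernel c r)"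
proof -
  define W where "W y = u y - H y" for y
  have W_cont: "continuous_on (cbox a b) W"
    unfolding W_def using u(2) harmonic_on_continuous[OF H(1)] sub(2)
    by (intro continuous_intros) (auto intro: continuous_on_subset)
  define N where "N s = integral (cbox a b) (\<lambda>y. W y * bump_kernel c s y)" for s
  define K where "K s = integral (cbox a b) (\<lambda>y. 1 * bump_kernel c s y)" for s
  have harm_const: "harmonic_on UNIV (\<lambda>_::real^'n. 1)"
  proof -
    have "partial_derivative i (\<lambda>_::real^'n. k) = (\<lambda>_. 0)" for i and k :: real
      using has_gradient_partial[OF has_gradient_const] by fastforce
    then show ?thesis by (simp add: harmonic_on_def laplacian_def)
  qed
  have conv: "integral (cbox a b) (\<lambda>y. w y * laplacian (bump c s) y) = (LINT y|lborel. w y * laplacian (bump c s) y)"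
    if "continuous_on (cbox a b) w" "0 < s" "s \<le> r" for w s
  proof (rule LINT_supported_cbox[symmetric])
    show "continuous_on (cbox a b) (\<lambda>y. w y * laplacian (bump c s) y)"
      by (intro continuous_intros that continuous_on_laplacian_bump)
    fix y assume "y \<notin> cbox a b"
    then have "y \<notin> ball c s" using sub(1) that(3) subset_ball[of s r c] ball_subset_cball[of c r] by blast
    then show "w y * laplacian (bump c s) y = 0" using that by (simp add: laplacian_bump_eq_0)
  qed
  have K_const: "K r = K s" if "0 < s" "s \<le> r" for s
  proof -
    have "(K has_real_derivative 0) (at t)" if t: "s \<le> t" "t \<le> r" for t
    proof -
      have "0 < t" using t \<open>0 < s\<close> by simp
      have "integral (cbox a b) (\<lambda>y. 1 * laplacian (bump c t) y) = 0"
        using conv[of "\<lambda>_. 1" t] LINT_harmonic_laplacian_bump[OF harm_const, of c t] t \<open>0 < t\<close> by simp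
      then show ?thesis
        using mollification_has_derivative[OF \<open>0 < t\<close>, of a b "\<lambda>_. 1" c] unfolding K_def[abs_def] by simp
    qed
    then show ?thesis
      using DERIV_nonpos_imp_nonincreasing[OF that(2), of K] DERIV_nonneg_imp_nondecreasing[OF that(2), of K]
      by (metis order_refl order_antisym)
  qed
  have N_mono: "N r \<le> N s" if "0 < s" "s \<le> r" for s
  proof (rule DERIV_nonpos_imp_nonincreasing[OF that(2)])
    fix t assume t: "s \<le> t" "t \<le> r"
    have "0 < t" using t that(1) by simp
    have sub_t: "cball c t \<subseteq> U" using sub t subset_cball[of t r c] by blast
    have u_c: "continuous_on (cbox a b) u" and H_c: "continuous_on (cbox a b) H"
      using u(2) harmonic_on_continuous[OF H(1)] sub(2) continuous_on_subset by blast+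
    have "integral (cbox a b) (\<lambda>y. W y * laplacian (bump c t) y)
       = integral (cbox a b) (\<lambda>y. u y * laplacian (bump c t) y) - integral (cbox a b) (\<lambda>y. H y * laplacian (bump c t) y)"
      unfolding W_def left_diff_distrib
      by (intro Henstock_Kurzweil_Integration.integral_diff integrable_continuous continuous_intros u_c H_c continuous_on_laplacian_bump)
    also have "\<dots> = (LINT y|lborel. u y * laplacian (bump c t) y)"
      using conv[OF u_c] conv[OF H_c] t \<open>0 < t\<close> LINT_harmonic_laplacian_bump[OF H sub_t] by simp
    also have "\<dots> \<le> 0"
      using u(1) bump_test_function[OF \<open>0 < t\<close>, of c] unfolding distr_superharmonic_def
      by (auto simp: bump_def exp_bump_nonneg)
    finally have "t / (2 * t ^ CARD('n)) * integral (cbox a b) (\<lambda>y. W y * laplacian (bump c t) y) \<le> 0"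
      using \<open>0 < t\<close> by (intro mult_nonneg_nonpos) auto
    then show "\<exists>y. (N has_real_derivative y) (at t) \<and> y \<le> 0"
      using mollification_has_derivative[OF \<open>0 < t\<close> W_cont, of c] unfolding N_def[abs_def] by blast
  qed
  have K_nonneg: "K s \<ge> 0" if "s > 0" for s
    unfolding K_def using that by (intro integral_nonneg) (auto intro!: integrable_continuous continuous_on_bump_kernel simp: bump_kernel_nonneg)
  have c_in: "c \<in> cbox a b" using sub(1) r by auto
  \<comment> \<open>at a small radius \<open>s\<close>, continuity bounds \<open>W\<close> by \<open>W c + \<eta>\<close> on the support of the kernel\<close>
  have "N r \<le> W c * K r + e" if "e > 0" for e
  proof -
    define \<eta> where "\<eta> = e / (K r + 1)"
    have \<eta>: "\<eta> > 0" "\<eta> * K r \<le> e"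
      using that K_nonneg[OF r] by (simp_all add: \<eta>_def field_simps)
    obtain d where d: "d > 0" "\<And>y. y \<in> cbox a b \<Longrightarrow> dist y c < d \<Longrightarrow> dist (W y) (W c) < \<eta>"
      using W_cont c_in \<eta>(1) unfolding continuous_on_iff by blast
    define s where "s = min d r"
    have s: "0 < s" "s \<le> r" using d r by (auto simp: s_def)
    have "N r \<le> N s" by (rule N_mono[OF s])
    also have "N s \<le> integral (cbox a b) (\<lambda>y. (W c + \<eta>) * (1 * bump_kernel c s y))"
      unfolding N_def
    proof (rule integral_le)
      show "(\<lambda>y. W y * bump_kernel c s y) integrable_on cbox a b"
        "(\<lambda>y. (W c + \<eta>) * (1 * bump_kernel c s y)) integrable_on cbox a b"
        by (intro integrable_continuous continuous_intros W_cont continuous_on_bump_kernel)+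
      fix y assume y: "y \<in> cbox a b"
      show "W y * bump_kernel c s y \<le> (W c + \<eta>) * (1 * bump_kernel c s y)"
      proof (cases "y \<in> ball c s")
        case True
        then have "W y \<le> W c + \<eta>"
          using d(2)[OF y] by (auto simp: s_def dist_real_def dist_commute)
        then show ?thesis using bump_kernel_nonneg[OF s(1), of c y] by (simp add: mult_right_mono)
      next
        case False
        then show ?thesis using s by (simp add: bump_kernel_eq_0)
      qed
    qed
    also have "\<dots> = (W c + \<eta>) * K s"
      unfolding K_def by (rule integral_mult_right)
    also have "\<dots> = W c * K r + \<eta> * K r"
      using K_const[OF s] by (simp add: distrib_right)
    finally show ?thesis using \<eta>(2) by simp
  qed
  then have "N r \<le> W c * K r" by (rule field_le_epsilon)
  then show ?thesis by (simp add: N_def K_def W_def)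
qed

text \<open>The kernel is positive on the open ball, so equality of a minimum with its average leaves no
  room for larger values.\<close>
lemma interior_minimum_locally_constant:
  fixes u H :: "real^'n::finite \<Rightarrow> real"
  assumes u: "distr_superharmonic u" "continuous_on UNIV u"
    and H: "harmonic_on U H" "open U" 
    and sub: "cball c r \<subseteq> cbox a b" "cbox a b \<subseteq> U" and r: "r > 0"
    and min: "\<And>y. y \<in> cbox a b \<Longrightarrow> u c - H c \<le> u y - H y"
    and y: "y \<in> ball c r"
  shows "u y - H y = u c - H c"
proof -
  define f where "f y = ((u y - H y) - (u c - H c)) * bump_kernel c r y" for y
  have u_c: "continuous_on (cbox a b) u" and H_c: "continuous_on (cbox a b) H"
    using u(2) harmonic_on_continuous[OF H(1)] sub(2) continuous_on_subset by blast+
  have f_c: "continuous_on (cbox a b) f"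
    unfolding f_def by (intro continuous_intros u_c H_c continuous_on_bump_kernel)
  have f_nonneg: "f y \<ge> 0" if "y \<in> cbox a b" for y
    using min[OF that] bump_kernel_nonneg[OF r, of c y] by (simp add: f_def)
  have "integral (cbox a b) f = integral (cbox a b) (\<lambda>y. (u y - H y) * bump_kernel c r y)
      - integral (cbox a b) (\<lambda>y. (u c - H c) * bump_kernel c r y)"
    unfolding f_def left_diff_distrib[of _ "u c - H c"]
    by (intro Henstock_Kurzweil_Integration.integral_diff integrable_continuous continuous_intros u_c H_c continuous_on_bump_kernel)
  also have "\<dots> \<le> 0"
    using supermean_inequality[OF u H sub r] by (simp add: integral_mult_right)
  finally have "integral (cbox a b) f = 0"
    using Henstock_Kurzweil_Integration.integral_nonneg[OF integrable_continuous[OF f_c] f_nonneg] by simp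
  moreover have ball_sub: "ball c r \<subseteq> box a b"
    using interior_maximal[OF subset_trans[OF ball_subset_cball sub(1)] open_ball] by (simp add: interior_cbox)
  then have "box a b \<noteq> {}" using r by fastforce
  ultimately have "f y = 0"
    using integral_cbox_eq_0_iff[OF f_c] f_nonneg ball_sub y box_subset_cbox by blast
  then show ?thesis using bump_kernel_pos[OF r y] by (simp add: f_def)
qed

section \<open>Comparison in exterior domains\<close>

text \<open>A maximum principle on the unbounded exterior of a ball. Decay of \<open>H\<close> against positivity of
  \<open>u\<close> makes a negative infimum of \<open>u - H\<close> attained. At a minimum point farthest from the origin,
  \<open>u - H\<close> would be constant in a ball, which contains minimum points that are farther still.\<close>
lemma exterior_comparison:
  fixes u H :: "real^'n::finite \<Rightarrow> real"
  assumes u: "distr_superharmonic u" "continuous_on UNIV u" "\<And>y. u y > 0"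
    and H: "harmonic_on (- {0}) H" "(H \<longlongrightarrow> 0) at_infinity"
    and R: "R > 0" and bd: "\<And>y. norm y = R \<Longrightarrow> H y \<le> u y"
    and y0: "norm y0 \<ge> R"
  shows "H y0 \<le> u y0"
proof (rule ccontr)
  define W where "W y = u y - H y" for y
  assume "\<not> H y0 \<le> u y0"
  then have neg: "W y0 < 0" by (simp add: W_def)
  have "eventually (\<lambda>y. \<bar>H y\<bar> < - W y0) at_infinity"
    using tendstoD[OF H(2), of "- W y0"] neg by (simp add: dist_real_def)
  then obtain \<rho> where "\<And>y. norm y \<ge> \<rho> \<Longrightarrow> \<bar>H y\<bar> < - W y0"
    unfolding eventually_at_infinity by blast
  then have far: "W y0 < W y" if "norm y \<ge> \<rho>" for y
    using that u(3)[of y] by (force simp: W_def)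
  define S where "S = {y::real^'n. R \<le> norm y \<and> norm y \<le> \<rho>}"
  have y0_S: "y0 \<in> S" using y0 far[of y0] by (force simp: S_def)
  have "S = cball 0 \<rho> - ball 0 R" by (auto simp: S_def)
  then have S: "compact S" by (simp add: compact_diff)
  have S_0: "S \<subseteq> - {0}" using R by (auto simp: S_def)
  have W_c: "continuous_on S W"
    unfolding W_def using u(2) harmonic_on_continuous[OF H(1)] S_0
    by (intro continuous_intros) (auto intro: continuous_on_subset)
  then obtain x1 where x1: "x1 \<in> S" "\<And>y. y \<in> S \<Longrightarrow> W x1 \<le> W y"
    using continuous_attains_inf[OF S _ W_c] y0_S by blast
  have min: "W x1 \<le> W y" if "norm y \<ge> R" for y
    using x1(2)[of y] x1(2)[OF y0_S] far[of y] that by (force simp: S_def)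
  define M where "M = {y \<in> S. W y = W x1}"
  have "closed M"
    unfolding M_def using continuous_closed_preimage_constant[OF W_c compact_imp_closed[OF S], of "W x1"]
    by simp
  then have "compact M"
    using compact_Int_closed[OF S] by (simp add: M_def Int_def conj_commute inf_commute) 
       (metis (mono_tags, lifting) M_def S \<open>closed M\<close> bounded_subset compact_eq_bounded_closed mem_Collect_eq subsetI)
  moreover have "x1 \<in> M" using x1 by (simp add: M_def)
  ultimately obtain x0 where x0: "x0 \<in> M" "\<And>y. y \<in> M \<Longrightarrow> norm y \<le> norm x0"
    using continuous_attains_sup[of M norm] continuous_on_norm_id by blast
  have W_x0: "W x0 = W x1" and "norm x0 \<ge> R" using x0 by (auto simp: M_def S_def)
  moreover have "norm x0 \<noteq> R"
    using bd[of x0] W_x0 x1(2)[OF y0_S] neg by (auto simp: W_def)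
  ultimately have "x0 \<in> {y. norm y > R}" by simp
  moreover have U: "open {y::real^'n. norm y > R}"
    by (intro open_Collect_less continuous_intros)
  ultimately obtain a b where ab: "x0 \<in> box a b" "cbox a b \<subseteq> {y. norm y > R}"
    using open_contains_cbox by metis
  obtain r where r: "r > 0" "cball x0 r \<subseteq> box a b"
    using open_contains_cball[of "box a b"] open_box ab(1) by blast
  define t where "t = r / (2 * norm x0)"
  have x0_pos: "norm x0 > 0" using \<open>norm x0 \<ge> R\<close> R by linarith
  have t: "t > 0" using r x0_pos by (simp add: t_def)
  define y where "y = (1 + t) *\<^sub>R x0"
  have "y \<in> ball x0 r"
    using r x0_pos t by (simp add: y_def dist_norm scaleR_left_distrib t_def)
  moreover have "harmonic_on {y. norm y > R} H"
  proof -
    have "{y. norm y > R} \<subseteq> - {0::real^'n}" using R by auto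
    then show ?thesis using H(1) unfolding harmonic_on_def by (meson continuous_on_subset subsetD)
  qed
  ultimately have "W y = W x0"
    unfolding W_def
    by (intro interior_minimum_locally_constant[OF u(1,2) _ U _ ab(2) r(1)])
      (use r ab W_x0 min in \<open>auto simp: W_def box_subset_cbox[THEN subsetD]\<close>)
  moreover have norm_y: "norm y > norm x0" using t x0_pos by (simp add: y_def)
  ultimately have "y \<in> M"
    using far[of y] W_x0 x1(2)[OF y0_S] \<open>norm x0 \<ge> R\<close> by (force simp: M_def S_def)
  then show False using x0(2) norm_y by fastforce
qed

lemma harmonic_onI:
  assumes U: "open U"
    and G: "\<And>x. x \<in> U \<Longrightarrow> has_gradient H (G x) x"
    and K: "\<And>x i. x \<in> U \<Longrightarrow> has_gradient (\<lambda>y. G y $ i) (K i x) x"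
    and cont: "\<And>i. continuous_on U (\<lambda>x. K i x $ i)"
    and zero: "\<And>x. x \<in> U \<Longrightarrow> (\<Sum>i\<in>UNIV. K i x $ i) = 0"
  shows "harmonic_on U H"
proof -
  have p: "partial_derivative i H x = G x $ i" if "x \<in> U" for x i
    using has_gradient_partial[OF G[OF that]] .
  have g: "has_gradient (partial_derivative i H) (K i x) x" if "x \<in> U" for x i
    using has_gradient_transform[OF K[OF that] U that] p by metis
  then have pp: "partial_derivative j (partial_derivative i H) x = K i x $ j" if "x \<in> U" for x i j
    using has_gradient_partial that by blast
  show ?thesis
    unfolding harmonic_on_def laplacian_def
    using G g pp zero cont by (auto intro: has_gradient_differentiable cong: continuous_on_cong)
qed

lemma harmonic_on_linear:
  assumes "open U" "harmonic_on U f" "harmonic_on U g"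
  shows "harmonic_on U (\<lambda>y. a * f y + b * g y)"
proof -
  let ?d = "\<lambda>f y. (\<chi> i. partial_derivative i f y)"
  have lin: "has_gradient (\<lambda>y. a * f y + b * g y) (a *\<^sub>R ?d f x + b *\<^sub>R ?d g x) x"
    if "f differentiable (at x)" "g differentiable (at x)" for f g :: "real^'n \<Rightarrow> real" and x
    using has_gradient_add[OF has_gradient_mult[OF has_gradient_const has_gradient_partials[OF that(1)]]
        has_gradient_mult[OF has_gradient_const has_gradient_partials[OF that(2)]], of a b] by simp
  show ?thesis
  proof (rule harmonic_onI[OF assms(1), where 
        G = "\<lambda>x. a *\<^sub>R ?d f x + b *\<^sub>R ?d g x" and
        K = "\<lambda>i x. a *\<^sub>R ?d (partial_derivative i f) x + b *\<^sub>R ?d (partial_derivative i g) x"])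
    fix x assume x: "x \<in> U"
    show "has_gradient (\<lambda>y. a * f y + b * g y) (a *\<^sub>R ?d f x + b *\<^sub>R ?d g x) x"
      using assms x by (intro lin) (auto simp: harmonic_on_def)
    fix i
    show "has_gradient (\<lambda>y. (a *\<^sub>R ?d f y + b *\<^sub>R ?d g y) $ i)
        (a *\<^sub>R ?d (partial_derivative i f) x + b *\<^sub>R ?d (partial_derivative i g) x) x"
      using lin[of "partial_derivative i f" x "partial_derivative i g"] assms x by (simp add: harmonic_on_def)
  next
    fix i show "continuous_on U (\<lambda>x. (a *\<^sub>R ?d (partial_derivative i f) x + b *\<^sub>R ?d (partial_derivative i g) x) $ i)"
      using assms by (auto simp: harmonic_on_def intro!: continuous_intros)
  next
    fix x assume x: "x \<in> U"
    have "laplacian f x = 0" "laplacian g x = 0" using assms x by (auto simp: harmonic_on_def)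
    then show "(\<Sum>i\<in>UNIV. (a *\<^sub>R ?d (partial_derivative i f) x + b *\<^sub>R ?d (partial_derivative i g) x) $ i) = 0"
      by (simp add: laplacian_def sum.distrib flip: sum_distrib_left)
  qed
qed

lemma has_gradient_inverse_norm_power:
  assumes "x \<noteq> 0"
  shows "has_gradient (\<lambda>y. 1 / norm y ^ m) ((- real m / norm x ^ (m + 2)) *\<^sub>R x) x"
proof -
  have "has_gradient norm (sgn x) x"
    using has_derivative_norm[OF assms] by (simp add: has_gradient_def inner_commute)
  moreover have "((\<lambda>t. 1 / t ^ m) has_real_derivative (- real m / t ^ (m + 1))) (at t)" if "t > 0" for t :: real
    by (rule back_subst[of "\<lambda>d. (_ has_real_derivative d) _",
          OF DERIV_divide[OF DERIV_const DERIV_pow]]) (use that in \<open>cases m; simp add: field_simps\<close>)+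
  ultimately have "has_gradient (\<lambda>y. 1 / norm y ^ m) ((- real m / norm x ^ (m + 1)) *\<^sub>R sgn x) x"
    using assms by (intro has_gradient_compose[where f = norm]) auto
  then show ?thesis by (simp add: sgn_div_norm field_simps)
qed

text \<open>The Kelvin transform of a harmonic polynomial, homogeneous of degree \<open>d\<close>, is harmonic. The
  polynomial \<open>q\<close> has degree at most two, so it is described by its affine gradient \<open>K *v y + v\<close>;
  then Euler's relation expresses homogeneity, and the trace of \<open>K\<close> is the Laplacian of \<open>q\<close>. The Laplacian of
  \<open>q / |y| ^ m\<close> is \<open>m * (m + 2 - n - 2 d) * q / |y| ^ (m + 2)\<close>, which vanishes for \<open>m = n - 2 + 2 d\<close>.\<close>
lemma harmonic_on_kelvin_homogeneous:
  fixes q :: "real^'n::finite \<Rightarrow> real" and K :: "real^'n^'n"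
  assumes n: "CARD('n) \<ge> 2"
    and q: "\<And>y. has_gradient q (K *v y + v) y"
    and homog: "\<And>y. (K *v y + v) \<bullet> y = real d * q y"
    and trace: "(\<Sum>i\<in>UNIV. K $ i $ i) = 0"
  shows "harmonic_on (- {0}) (\<lambda>y. q y / norm y ^ (CARD('n) - 2 + 2 * d))"
proof -
  define m where "m = CARD('n) - 2 + 2 * d"
  have m: "real m + 2 = real CARD('n) + 2 * real d" using n by (simp add: m_def)
  define G where "G y = K *v y + v" for y
  have K_grad: "has_gradient (\<lambda>y. G y $ i) (K $ i) x" for i x
  proof -
    have "(\<lambda>y. G y $ i) = (\<lambda>y. K $ i \<bullet> y + v $ i)"
      by (simp add: G_def fun_eq_iff matrix_vector_mult_def inner_vec_def)
    then show ?thesis by (auto simp: has_gradient_def intro!: derivative_eq_intros)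
  qed
  have coord: "has_gradient (\<lambda>y. y $ i) (axis i 1) x" for i and x :: "real^'n"
    using has_gradient_coord[of i 0 x] by simp
  define F where "F y = q y *\<^sub>R ((- real m / norm y ^ (m + 2)) *\<^sub>R y) + (1 / norm y ^ m) *\<^sub>R G y" for y
  define E where "E i x = (- real m) *\<^sub>R (q x *\<^sub>R (x $ i *\<^sub>R ((- real (m + 2) / norm x ^ (m + 2 + 2)) *\<^sub>R x) + (1 / norm x ^ (m + 2)) *\<^sub>R axis i 1)
            + (x $ i * (1 / norm x ^ (m + 2))) *\<^sub>R G x) + (q x * (x $ i * (1 / norm x ^ (m + 2)))) *\<^sub>R 0
         + (G x $ i *\<^sub>R ((- real m / norm x ^ (m + 2)) *\<^sub>R x) + (1 / norm x ^ m) *\<^sub>R (K $ i))" for i x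
  have "harmonic_on (- {0}) (\<lambda>y. q y * (1 / norm y ^ m))"
  proof (rule harmonic_onI[where G = F and K = E])
    fix x :: "real^'n" assume x: "x \<in> - {0}"
    then have x0: "x \<noteq> 0" by simp
    show "has_gradient (\<lambda>y. q y * (1 / norm y ^ m)) (F x) x"
      unfolding F_def G_def by (rule has_gradient_mult[OF q has_gradient_inverse_norm_power[OF x0]])
    fix i
    have "has_gradient (\<lambda>y. (- real m) * (q y * (y $ i * (1 / norm y ^ (m + 2)))) + G y $ i * (1 / norm y ^ m)) (E i x) x"
      unfolding E_def
      by (intro has_gradient_add has_gradient_mult has_gradient_const q[folded G_def] coord K_grad
          has_gradient_inverse_norm_power x0)
    moreover have "(\<lambda>y. (- real m) * (q y * (y $ i * (1 / norm y ^ (m + 2)))) + G y $ i * (1 / norm y ^ m)) = (\<lambda>y. F y $ i)"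
      by (simp add: F_def fun_eq_iff mult_ac)
    ultimately show "has_gradient (\<lambda>y. F y $ i) (E i x) x"
      by simp
  next
    fix i
    have "continuous_on UNIV q"
      using q by (auto intro!: continuous_at_imp_continuous_on differentiable_imp_continuous_within
        has_gradient_differentiable)
    then have "continuous_on (- {0}) q" by (rule continuous_on_subset) simp
    moreover have "continuous_on (- {0}) (\<lambda>x. G x $ i)"
      using K_grad by (auto intro!: continuous_at_imp_continuous_on differentiable_imp_continuous_within
        has_gradient_differentiable)
    ultimately show "continuous_on (- {0}) (\<lambda>x. E i x $ i)"
      unfolding E_def by (auto intro!: continuous_intros)
  next
    fix x :: "real^'n" assume x: "x \<in> - {0}"
    define N where "N = norm x"
    have N: "N > 0" using x by (simp add: N_def)
    have comp: "E i x $ i = real m * real (m + 2) * q x / N ^ (m + 4) * (x $ i * x $ i) - real m * q x / N ^ (m + 2)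
        - 2 * real m / N ^ (m + 2) * (G x $ i * x $ i) + 1 / N ^ m * (K $ i $ i)" for i
      by (simp add: E_def N_def axis_def algebra_simps eval_nat_numeral)
    have sq: "(\<Sum>i\<in>UNIV. x $ i * x $ i) = N\<^sup>2"
      by (simp add: N_def power2_norm_eq_inner inner_vec_def)
    have euler: "(\<Sum>i\<in>UNIV. G x $ i * x $ i) = real d * q x"
      using homog[of x] by (simp add: G_def inner_vec_def)
    have "(\<Sum>i\<in>UNIV. E i x $ i) = real m * real (m + 2) * q x / N ^ (m + 4) * N\<^sup>2 - real CARD('n) * (real m * q x / N ^ (m + 2))
        - 2 * real m / N ^ (m + 2) * (real d * q x) + 1 / N ^ m * 0"
      unfolding comp sum.distrib sum_subtractf sum_distrib_left[symmetric] sq euler trace by simp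
    also have "\<dots> = real m * q x / N ^ (m + 2) * (real m + 2 - real CARD('n) - 2 * real d)"
      using N by (simp add: power_add field_simps eval_nat_numeral)
    finally show "(\<Sum>i\<in>UNIV. E i x $ i) = 0" using m by simp
  qed auto
  then show ?thesis by (simp add: m_def)
qed

lemma kelvin_homogeneous_tendsto_0:
  fixes q :: "real^'n::finite \<Rightarrow> real"
  assumes bound: "\<And>y. \<bar>q y\<bar> \<le> C * norm y ^ d" and "m > d"
  shows "((\<lambda>y. q y / norm y ^ m) \<longlongrightarrow> 0) at_infinity"
proof (rule Lim_null_comparison)
  show "\<forall>\<^sub>F y in at_infinity. norm (q y / norm y ^ m) \<le> \<bar>C\<bar> * (1 / norm y)"
    unfolding eventually_at_infinity
  proof (intro exI allI impI)
    fix y :: "real^'n" assume y: "1 \<le> norm y"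
    have "\<bar>q y\<bar> * norm y \<le> \<bar>C\<bar> * norm y ^ d * norm y"
      using bound[of y] by (intro mult_right_mono) (auto intro: order_trans[OF bound mult_right_mono])
    also have "\<dots> = \<bar>C\<bar> * norm y ^ (d + 1)" by simp
    also have "\<dots> \<le> \<bar>C\<bar> * norm y ^ m"
      using assms(2) y by (intro mult_left_mono power_increasing) auto
    finally show "norm (q y / norm y ^ m) \<le> \<bar>C\<bar> * (1 / norm y)"
      using y divide_right_mono[of "\<bar>q y\<bar> * norm y" "\<bar>C\<bar> * norm y ^ m" "norm y * norm y ^ m"] 
      by (auto simp: mult_ac split: if_splits)
  qed
  show "((\<lambda>y::real^'n. \<bar>C\<bar> * (1 / norm y)) \<longlongrightarrow> 0) at_infinity"
    by (intro tendsto_mult_right_zero tendsto_divide_0[OF tendsto_const] filterlim_at_top_imp_at_infinity filterlim_norm_at_top)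
qed

section \<open>Behaviour of superharmonic functions at infinity\<close>

lemma harmonic_inverse_power:
  assumes "CARD('n::finite) \<ge> 2"
  shows "harmonic_on (- {0}) (\<lambda>y::real^'n. 1 / norm y ^ (CARD('n) - 2))"
  using harmonic_on_kelvin_homogeneous[OF assms, of "\<lambda>_. 1" 0 0 0]
  by (simp add: has_gradient_const)

lemma harmonic_linear:
  assumes "CARD('n::finite) \<ge> 2"
  shows "harmonic_on (- {0}) (\<lambda>y::real^'n. (v \<bullet> y) / norm y ^ (CARD('n) - 2 + 2))"
proof -
  have "has_gradient (\<lambda>y. v \<bullet> y) v y" for y
    by (auto simp: has_gradient_def intro!: derivative_eq_intros)
  then show ?thesis
    using harmonic_on_kelvin_homogeneous[OF assms, of "\<lambda>y. v \<bullet> y" 0 v 1] by simp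
qed

lemma harmonic_quadratic:
  fixes p :: "real^'n::finite"
  assumes "CARD('n) \<ge> 2"
  shows "harmonic_on (- {0}) (\<lambda>y. ((p \<bullet> y)\<^sup>2 - (norm p)\<^sup>2 / real CARD('n) * (norm y)\<^sup>2) / norm y ^ (CARD('n) - 2 + 4))"
proof -
  define c where "c = (norm p)\<^sup>2 / real CARD('n)"
  define q where "q y = (p \<bullet> y)\<^sup>2 - c * (norm y)\<^sup>2" for y
  define K :: "real^'n^'n" where "K = (\<chi> i j. 2 * p $ i * p $ j - (if i = j then 2 * c else 0))"
  have K: "K *v y = (2 * (p \<bullet> y)) *\<^sub>R p - (2 * c) *\<^sub>R y" for y
  proof (rule vec_eq_iff[THEN iffD2, rule_format])
    fix i
    have "(K *v y) $ i = (\<Sum>j\<in>UNIV. 2 * p $ i * (p $ j * y $ j) - (if i = j then 2 * c * y $ j else 0))"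
      unfolding K_def matrix_vector_mult_def by (auto intro!: sum.cong simp: algebra_simps)
    also have "\<dots> = 2 * p $ i * (p \<bullet> y) - 2 * c * y $ i"
      by (simp add: sum_subtractf inner_vec_def flip: sum_distrib_left)
    finally show "(K *v y) $ i = ((2 * (p \<bullet> y)) *\<^sub>R p - (2 * c) *\<^sub>R y) $ i" by simp
  qed
  have "has_gradient q (K *v y + 0) y" for y
    unfolding q_def K has_gradient_def power2_norm_eq_inner
    by (auto intro!: derivative_eq_intros simp: fun_eq_iff inner_diff_left inner_commute algebra_simps)
  moreover have "(K *v y + 0) \<bullet> y = real 2 * q y" for y
    unfolding q_def K by (simp add: inner_diff_left dot_square_norm power2_eq_square)
  moreover have "(\<Sum>i\<in>UNIV. K $ i $ i) = 0"
  proof -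
    have "(\<Sum>i\<in>UNIV. K $ i $ i) = 2 * (\<Sum>i\<in>UNIV. p $ i * p $ i) - real CARD('n) * (2 * c)"
      by (simp add: K_def sum_subtractf sum_distrib_left mult_ac)
    also have "(\<Sum>i\<in>UNIV. p $ i * p $ i) = (norm p)\<^sup>2"
      by (simp add: power2_norm_eq_inner inner_vec_def)
    finally show ?thesis by (simp add: c_def)
  qed
  ultimately have "harmonic_on (- {0}) (\<lambda>y. q y / norm y ^ (CARD('n) - 2 + 2 * 2))"
    by (rule harmonic_on_kelvin_homogeneous[OF assms])
  then show ?thesis by (simp add: q_def[abs_def] c_def)
qed

text \<open>Comparison with a multiple of the fundamental solution.\<close>
lemma superharmonic_lower_bound:
  fixes u :: "real^'n::finite \<Rightarrow> real"
  assumes n: "CARD('n) \<ge> 3"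
    and u: "distr_superharmonic u" "continuous_on UNIV u" "\<And>y. u y > 0"
  obtains c where "c > 0" "\<And>y. norm y \<ge> 1 \<Longrightarrow> c / norm y ^ (CARD('n) - 2) \<le> u y"
proof -
  obtain i :: 'n where True by blast
  have "axis i 1 \<in> sphere (0::real^'n) 1" by simp
  then obtain x0 where x0: "\<And>y. y \<in> sphere 0 1 \<Longrightarrow> u x0 \<le> u y"
    using continuous_attains_inf[of "sphere 0 1" u] continuous_on_subset[OF u(2)] by (metis compact_sphere empty_iff subset_UNIV)
  have H: "harmonic_on (- {0}) (\<lambda>y::real^'n. u x0 * (1 / norm y ^ (CARD('n) - 2)) + 0 * (1 / norm y ^ (CARD('n) - 2)))"
    using n by (intro harmonic_on_linear harmonic_inverse_power) auto
  have lim: "((\<lambda>y::real^'n. u x0 / norm y ^ (CARD('n) - 2)) \<longlongrightarrow> 0) at_infinity"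
    by (rule kelvin_homogeneous_tendsto_0[of "\<lambda>_. u x0" "u x0" 0]) (use n u(3)[of x0] in auto)
  have "u x0 / norm y ^ (CARD('n) - 2) \<le> u y" if "norm y \<ge> 1" for y
    by (rule exterior_comparison[OF u, of "\<lambda>y. u x0 / norm y ^ (CARD('n) - 2)" 1])
      (use H lim x0 that in auto)
  then show thesis using that u(3) by blast
qed

text \<open>After inversion \<open>z = y / |y|\<^sup>2\<close>, the function \<open>|y| ^ (n - 2) * u y\<close> is superharmonic near
  \<open>z = 0\<close>, away from \<open>0\<close>, and it lies above two smooth functions that share the value \<open>\<alpha>\<close> at \<open>0\<close>. If their gradients
  differ, it lies above a wedge \<open>\<alpha> + V \<bullet> z + |p \<bullet> z|\<close> up to \<open>o(|z|)\<close>. On a small sphere the wedge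
  dominates a harmonic quadratic polynomial whose value at \<open>0\<close> exceeds \<open>\<alpha>\<close>, and comparison carries
  this strict gain to \<open>z = 0\<close>. The proof works with Kelvin transforms of such polynomials, so that
  the comparison takes place in the exterior domain.\<close>
lemma distinct_gradients_raise_limit:
  fixes u :: "real^'n::finite \<Rightarrow> real"
  assumes n: "CARD('n) \<ge> 3"
    and u: "distr_superharmonic u" "continuous_on UNIV u" "\<And>y. u y > 0"
    and exp1: "\<And>\<epsilon>. \<epsilon> > 0 \<Longrightarrow> \<forall>\<^sub>F y in at_infinity. \<alpha> + (g1 \<bullet> y) / (norm y)\<^sup>2 - \<epsilon> / norm y \<le> norm y ^ (CARD('n) - 2) * u y"
    and exp2: "\<And>\<epsilon>. \<epsilon> > 0 \<Longrightarrow> \<forall>\<^sub>F y in at_infinity. \<alpha> + (g2 \<bullet> y) / (norm y)\<^sup>2 - \<epsilon> / norm y \<le> norm y ^ (CARD('n) - 2) * u y"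
    and neq: "g1 \<noteq> g2"
  obtains t where "t > \<alpha>" "\<forall>\<^sub>F y in at_infinity. t < norm y ^ (CARD('n) - 2) * u y"
proof -
  define \<nu> where "\<nu> = CARD('n) - 2"
  define N where "N = real CARD('n)"
  have N: "N > 0" by (simp add: N_def)
  define V where "V = (1/2) *\<^sub>R (g1 + g2)"
  define p where "p = (1/2) *\<^sub>R (g1 - g2)"
  define P where "P = norm p"
  have P: "P > 0" using neq by (simp add: P_def p_def)
  have g: "g1 = V + p" "g2 = V - p"
    by (simp_all add: V_def p_def algebra_simps flip: scaleR_left_distrib)
  define \<epsilon> where "\<epsilon> = P / (2 * N)"
  have \<epsilon>: "\<epsilon> > 0" using P N by (simp add: \<epsilon>_def)
  obtain R1 R2 where
    R1: "\<And>y. R1 \<le> norm y \<Longrightarrow> \<alpha> + (g1 \<bullet> y) / (norm y)\<^sup>2 - \<epsilon> / norm y \<le> norm y ^ \<nu> * u y" and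
    R2: "\<And>y. R2 \<le> norm y \<Longrightarrow> \<alpha> + (g2 \<bullet> y) / (norm y)\<^sup>2 - \<epsilon> / norm y \<le> norm y ^ \<nu> * u y"
    using exp1[OF \<epsilon>] exp2[OF \<epsilon>] unfolding eventually_at_infinity \<nu>_def by blast
  define R where "R = max 1 (max R1 R2)"
  have R: "R > 0" "R \<ge> R1" "R \<ge> R2" by (auto simp: R_def)
  define q where "q y = (p \<bullet> y)\<^sup>2 - P\<^sup>2 / N * (norm y)\<^sup>2" for y
  \<comment> \<open>on \<open>|y| = R\<close>, i.e. \<open>|z| = 1 / R\<close>, the wedge \<open>|p \<bullet> z|\<close> is at least
    \<open>R / P * (p \<bullet> z)\<^sup>2\<close>; subtracting its spherical mean leaves a harmonic polynomial and a gain
    \<open>P / (N R) = 2 \<epsilon> / R\<close>, of which the error term \<open>\<epsilon> / R\<close> takes half\<close>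
  define H where "H y = 1 * ((\<alpha> + \<epsilon> / R) * (1 / norm y ^ \<nu>) + 1 * ((V \<bullet> y) / norm y ^ (\<nu> + 2))) 
      + R / P * (q y / norm y ^ (\<nu> + 4))" for y
  have H_harm: "harmonic_on (- {0}) H"
    unfolding H_def[abs_def] q_def \<nu>_def P_def N_def using n
    by (intro harmonic_on_linear harmonic_inverse_power harmonic_linear harmonic_quadratic) auto
  have V_bound: "\<bar>V \<bullet> y\<bar> \<le> norm V * norm y ^ 1" for y
    using Cauchy_Schwarz_ineq2[of V y] by simp
  have q_bound: "\<bar>q y\<bar> \<le> (P\<^sup>2 + P\<^sup>2 / N) * norm y ^ 2" for y
  proof -
    have "(p \<bullet> y)\<^sup>2 \<le> P\<^sup>2 * (norm y)\<^sup>2"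
      using power_mono[OF Cauchy_Schwarz_ineq2[of p y], of 2] by (simp add: P_def power_mult_distrib)
    then show ?thesis
      using N unfolding q_def by (auto simp: abs_le_iff algebra_simps) (smt (verit) divide_nonneg_nonneg mult_nonneg_nonneg zero_le_power2)+
  qed
  have \<nu>: "\<nu> \<ge> 1" using n by (simp add: \<nu>_def)
  have H_lim: "(H \<longlongrightarrow> 0) at_infinity"
    unfolding H_def[abs_def] using \<nu>
    by (intro tendsto_add_zero tendsto_mult_right_zero kelvin_homogeneous_tendsto_0[where d = 0]
        kelvin_homogeneous_tendsto_0[OF V_bound] kelvin_homogeneous_tendsto_0[OF q_bound]) auto
  have H_eq: "norm y ^ \<nu> * H y = \<alpha> + \<epsilon> / R + (V \<bullet> y) / norm y ^ 2 + R / P * (q y / norm y ^ 4)" if "norm y > 0" for y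
    using that by (simp add: H_def power_add field_simps eval_nat_numeral)
  have "H y \<le> u y" if y: "norm y = R" for y
  proof -
    have "(p \<bullet> y)\<^sup>2 = \<bar>p \<bullet> y\<bar> * \<bar>p \<bullet> y\<bar>" by (simp add: power2_eq_square flip: abs_mult)
    also have "\<dots> \<le> \<bar>p \<bullet> y\<bar> * (P * R)"
      using Cauchy_Schwarz_ineq2[of p y] y by (intro mult_left_mono) (auto simp: P_def)
    finally have *: "(p \<bullet> y)\<^sup>2 / (P * R ^ 3) \<le> \<bar>p \<bullet> y\<bar> / R\<^sup>2"
      using P R(1) by (simp add: field_simps eval_nat_numeral)
    have "norm y ^ \<nu> * H y = \<alpha> + \<epsilon> / R + (V \<bullet> y) / R\<^sup>2 + ((p \<bullet> y)\<^sup>2 / (P * R ^ 3) - P / (N * R))"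
      using y R P N by (subst H_eq) (auto simp: q_def field_simps eval_nat_numeral)
    also have "\<dots> \<le> \<alpha> + (V \<bullet> y) / R\<^sup>2 + \<bar>p \<bullet> y\<bar> / R\<^sup>2 - \<epsilon> / R"
    proof -
      have "P / (N * R) = \<epsilon> / R + \<epsilon> / R" using N by (simp add: \<epsilon>_def field_simps)
      with * show ?thesis by linarith
    qed
    also have "\<dots> \<le> norm y ^ \<nu> * u y"
      using R1[of y] R2[of y] y R by (auto simp: g inner_add_left inner_diff_left abs_if add_divide_distrib diff_divide_distrib)
    finally show ?thesis using y R(1) by (simp add: mult_le_cancel_left)
  qed
  then have cmp: "H y \<le> u y" if "norm y \<ge> R" for y
    using exterior_comparison[OF u H_harm H_lim R(1)] that by blast
  have "((\<lambda>y. (V \<bullet> y) / norm y ^ 2 + R / P * (q y / norm y ^ 4)) \<longlongrightarrow> 0) at_infinity"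
    by (intro tendsto_add_zero tendsto_mult_right_zero
        kelvin_homogeneous_tendsto_0[OF V_bound] kelvin_homogeneous_tendsto_0[OF q_bound]) auto
  moreover have "\<epsilon> / (2 * R) > 0" using \<epsilon> R by simp
  ultimately have "\<forall>\<^sub>F y in at_infinity. dist ((V \<bullet> y) / norm y ^ 2 + R / P * (q y / norm y ^ 4)) 0 < \<epsilon> / (2 * R)"
    by (rule tendstoD)
  then have "\<forall>\<^sub>F y in at_infinity. \<bar>(V \<bullet> y) / norm y ^ 2 + R / P * (q y / norm y ^ 4)\<bar> < \<epsilon> / (2 * R)"
    unfolding dist_real_def diff_zero .
  moreover have "\<forall>\<^sub>F y::real^'n in at_infinity. norm y \<ge> R"
    unfolding eventually_at_infinity by blast
  ultimately have "\<forall>\<^sub>F y in at_infinity. \<alpha> + \<epsilon> / (2 * R) < norm y ^ \<nu> * u y"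
  proof eventually_elim
    case (elim y)
    have "\<alpha> + \<epsilon> / (2 * R) < norm y ^ \<nu> * H y"
    proof -
      have "\<epsilon> / R = \<epsilon> / (2 * R) + \<epsilon> / (2 * R)" by simp
      moreover have "norm y > 0" using elim(2) R(1) by linarith
      ultimately show ?thesis using elim(1) H_eq[of y] by linarith
    qed
    also have "\<dots> \<le> norm y ^ \<nu> * u y"
      using cmp[OF elim(2)] by (intro mult_left_mono) auto
    finally show ?case .
  qed
  then show thesis
    using that[of "\<alpha> + \<epsilon> / (2 * R)"] \<epsilon> R by (simp add: \<nu>_def)
qed

section \<open>Expansion of the Kelvin transform at infinity\<close>

text \<open>In the inverted variable \<open>z = y / |y|\<^sup>2\<close>, the function \<open>|y| ^ (n - 2) * kelvin u x lam y\<close> is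
  \<open>w z = lam ^ (n - 2) * D z powr (- (n - 2) / 2) * u (\<Phi> z)\<close>, where \<open>D z = |y - x|\<^sup>2 / |y|\<^sup>2\<close> and
  \<open>\<Phi> z\<close> is the reflected point. Both are smooth at \<open>z = 0\<close>, and the claim is the first-order
  Taylor expansion of \<open>w\<close> there.\<close>
lemma kelvin_expansion:
  fixes u :: "real^'n::finite \<Rightarrow> real"
  assumes grad: "has_gradient u v x"
    and "\<epsilon> > 0"
  shows "\<forall>\<^sub>F y in at_infinity.
     lam ^ (CARD('n) - 2) * u x
       + (lam ^ (CARD('n) - 2) *\<^sub>R ((real (CARD('n) - 2) * u x) *\<^sub>R x + lam\<^sup>2 *\<^sub>R v) \<bullet> y) / (norm y)\<^sup>2
       - \<epsilon> / norm y \<le> norm y ^ (CARD('n) - 2) * kelvin u x lam y"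
proof -
  define \<nu> where "\<nu> = CARD('n) - 2"
  define D where "D z = 1 - 2 * (x \<bullet> z) + (x \<bullet> x) * (z \<bullet> z)" for z :: "real^'n"
  define \<Phi> where "\<Phi> z = x + (lam\<^sup>2 / D z) *\<^sub>R (z - (z \<bullet> z) *\<^sub>R x)" for z
  define w where "w z = lam ^ \<nu> * (D z powr (- real \<nu> / 2) * u (\<Phi> z))" for z
  define G where "G = lam ^ \<nu> *\<^sub>R ((real \<nu> * u x) *\<^sub>R x + lam\<^sup>2 *\<^sub>R v)"
  have D0: "D 0 = 1" and Phi0: "\<Phi> 0 = x" by (simp_all add: D_def \<Phi>_def)
  have D_grad: "has_gradient D (- 2 *\<^sub>R x) 0"
    unfolding D_def has_gradient_def by (auto intro!: derivative_eq_intros simp: fun_eq_iff)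
  have "((\<lambda>t. t powr (- real \<nu> / 2)) has_real_derivative (- real \<nu> / 2)) (at (D 0))"
    unfolding D0 by (auto intro!: derivative_eq_intros)
  from has_gradient_compose[OF this D_grad]
  have 1: "has_gradient (\<lambda>z. D z powr (- real \<nu> / 2)) (real \<nu> *\<^sub>R x) 0"
    by simp
  have Phi_der: "(\<Phi> has_derivative (\<lambda>h. lam\<^sup>2 *\<^sub>R h)) (at 0)"
    unfolding \<Phi>_def using D_grad[unfolded has_gradient_def] D0
    by (auto intro!: derivative_eq_intros)
  have 2: "has_gradient (\<lambda>z. u (\<Phi> z)) (lam\<^sup>2 *\<^sub>R v) 0"
    using has_derivative_compose[OF Phi_der, of u "\<lambda>h. v \<bullet> h"] grad
    unfolding has_gradient_def inner_scaleR_left by (simp add: Phi0)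
  have "has_gradient w (lam ^ \<nu> *\<^sub>R (D 0 powr (- real \<nu> / 2) *\<^sub>R (lam\<^sup>2 *\<^sub>R v) + u (\<Phi> 0) *\<^sub>R (real \<nu> *\<^sub>R x))
      + (D 0 powr (- real \<nu> / 2) * u (\<Phi> 0)) *\<^sub>R 0) 0"
    unfolding w_def by (rule has_gradient_mult[OF has_gradient_const has_gradient_mult[OF 1 2]])
  then have w_grad: "has_gradient w G 0"
    by (simp add: D0 Phi0 G_def algebra_simps)
  have w0: "w 0 = lam ^ \<nu> * u x" by (simp add: w_def D0 Phi0)
  obtain d where d: "d > 0" "\<And>z. norm z < d \<Longrightarrow> \<bar>w z - w 0 - G \<bullet> z\<bar> \<le> \<epsilon> * norm z"
    using w_grad \<open>\<epsilon> > 0\<close> unfolding has_gradient_def has_derivative_at_alt by force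
  show ?thesis
    unfolding eventually_at_infinity \<nu>_def[symmetric] G_def[symmetric]
  proof (intro exI allI impI)
    fix y :: "real^'n" assume y: "max (norm x + 1) (1 / d + 1) \<le> norm y"
    have y_pos: "norm y > 0" and y_x: "norm (y - x) > 0" using y norm_ge_zero[of x] by (auto simp del: norm_ge_zero)
    define z where "z = (1 / (norm y)\<^sup>2) *\<^sub>R y"
    have norm_z: "norm z = 1 / norm y" using y_pos by (simp add: z_def power2_eq_square)
    have "norm z < d" using y y_pos d(1) unfolding norm_z by (simp add: field_simps)
    then have "w 0 + G \<bullet> z - \<epsilon> * norm z \<le> w z" using d(2)[of z] by (simp add: abs_le_iff)
    moreover have "w z = norm y ^ \<nu> * kelvin u x lam y"
    proof -
      have zz: "z \<bullet> z = 1 / (norm y)\<^sup>2"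
        using norm_z by (simp add: dot_square_norm power_divide)
      have "D z = (norm y)\<^sup>2 / (norm y)\<^sup>2 - 2 * (x \<bullet> y) / (norm y)\<^sup>2 + (x \<bullet> x) / (norm y)\<^sup>2"
        unfolding D_def zz using y_pos by (simp add: z_def)
      also have "\<dots> = (norm (y - x))\<^sup>2 / (norm y)\<^sup>2"
        by (simp add: power2_norm_eq_inner inner_diff_left inner_diff_right inner_commute diff_divide_distrib add_divide_distrib)
      finally have Dz: "D z = (norm (y - x) / norm y)\<^sup>2" by (simp add: power_divide)
      have "D z powr (- real \<nu> / 2) = ((norm (y - x) / norm y) powr 2) powr (- real \<nu> / 2)"
        unfolding Dz using y_pos y_x by (simp add: powr_realpow[of _ 2, simplified])
      also have "\<dots> = (norm (y - x) / norm y) powr (- real \<nu>)"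
        by (subst powr_powr) simp
      also have "\<dots> = (norm y / norm (y - x)) ^ \<nu>"
        using y_pos y_x by (simp add: powr_minus powr_realpow power_divide)
      finally have P: "D z powr (- real \<nu> / 2) = (norm y / norm (y - x)) ^ \<nu>" .
      have "z - (z \<bullet> z) *\<^sub>R x = (1 / (norm y)\<^sup>2) *\<^sub>R (y - x)"
        unfolding zz by (simp add: z_def scaleR_right_diff_distrib)
      then have "\<Phi> z = x + (lam\<^sup>2 / (norm (y - x))\<^sup>2) *\<^sub>R (y - x)"
        using y_pos by (simp add: \<Phi>_def Dz power_divide)
      then show ?thesis
        unfolding w_def P kelvin_def by (simp add: \<nu>_def power_divide)
    qed
    ultimately show "lam ^ \<nu> * u x + (G \<bullet> y) / (norm y)\<^sup>2 - \<epsilon> / norm y \<le> norm y ^ \<nu> * kelvin u x lam y"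
      by (simp add: w0 norm_z) (simp add: z_def)
  qed
qed

section \<open>Moving spheres\<close>

lemma kelvin_on_sphere: "lam > 0 \<Longrightarrow> norm (y - x) = lam \<Longrightarrow> kelvin u x lam y = u y"
  by (simp add: kelvin_def)

text \<open>The ratio \<open>|y| / |y - x|\<close> is bounded when \<open>|y - x| \<ge> r\<close>, which moves the centre of
  the bound of \<open>superharmonic_lower_bound\<close>; on the unit ball, \<open>u\<close> has a positive minimum.\<close>
lemma lower_bound_off_centre:
  fixes u :: "real^'n::finite \<Rightarrow> real"
  assumes n: "CARD('n) \<ge> 3"
    and u: "distr_superharmonic u" "continuous_on UNIV u" "\<And>y. u y > 0"
    and r: "r > 0"
  obtains c where "c > 0" "\<And>y. norm (y - x) \<ge> r \<Longrightarrow> c / norm (y - x) ^ (CARD('n) - 2) \<le> u y"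
proof -
  define \<nu> where "\<nu> = CARD('n) - 2"
  obtain c where c: "c > 0" "\<And>y. norm y \<ge> 1 \<Longrightarrow> c / norm y ^ \<nu> \<le> u y"
    using superharmonic_lower_bound[OF n u] unfolding \<nu>_def by blast
  obtain y1 where y1: "\<And>y. y \<in> cball 0 1 \<Longrightarrow> u y1 \<le> u y"
    using continuous_attains_inf[of "cball 0 1" u] continuous_on_subset[OF u(2)]
    by (metis centre_in_cball compact_cball empty_iff subset_UNIV zero_le_one)
  define k where "k = 1 + norm x / r"
  have k: "k \<ge> 1" using r by (simp add: k_def)
  define c' where "c' = min (c / k ^ \<nu>) (u y1 * r ^ \<nu>)"
  have c'_pos: "c' > 0" using c(1) k u(3)[of y1] r by (simp add: c'_def)
  have "c' / norm (y - x) ^ \<nu> \<le> u y" if y: "norm (y - x) \<ge> r" for y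
  proof (cases "norm y \<ge> 1")
    case True
    have "norm y \<le> norm (y - x) + norm x" using norm_triangle_ineq[of "y - x" x] by simp
    also have "norm x \<le> norm (y - x) * (norm x / r)"
      using y r mult_right_mono[OF y, of "norm x / r"] by simp
    finally have "norm y \<le> k * norm (y - x)" by (simp add: k_def algebra_simps)
    then have "norm y ^ \<nu> \<le> (k * norm (y - x)) ^ \<nu>" by (intro power_mono) auto
    then have "c / (k * norm (y - x)) ^ \<nu> \<le> c / norm y ^ \<nu>"
      using True c(1) by (intro frac_le zero_less_power) auto
    moreover have "c' / norm (y - x) ^ \<nu> \<le> c / k ^ \<nu> / norm (y - x) ^ \<nu>"
      by (intro divide_right_mono) (auto simp: c'_def)
    ultimately show ?thesis using c(2)[OF True] by (simp add: power_mult_distrib)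
  next
    case False
    have "c' / norm (y - x) ^ \<nu> \<le> u y1 * r ^ \<nu> / norm (y - x) ^ \<nu>"
      by (intro divide_right_mono) (auto simp: c'_def)
    also have "\<dots> \<le> u y1 * r ^ \<nu> / r ^ \<nu>"
      using y r u(3)[of y1] by (intro frac_le power_mono) auto
    also have "\<dots> \<le> u y" using y1[of y] False r by simp
    finally show ?thesis .
  qed
  then show thesis using that c'_pos unfolding \<nu>_def by blast
qed

lemma kelvin_le_of_ball_bound:
  fixes u :: "real^'n::finite \<Rightarrow> real"
  assumes "lam > 0" "norm (y - x) > 0" "lam\<^sup>2 / norm (y - x) \<le> d"
    and "\<And>z. norm (z - x) \<le> d \<Longrightarrow> u z \<le> m"
  shows "kelvin u x lam y \<le> lam ^ (CARD('n) - 2) / norm (y - x) ^ (CARD('n) - 2) * m"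
  unfolding kelvin_def using assms
  by (intro mult_left_mono) (auto simp: power2_eq_square)

text \<open>Near \<open>x\<close>, both \<open>y\<close> and its reflection are close to \<open>x\<close>, where \<open>u\<close> is almost constant, and
  the factor \<open>1 + \<delta>\<close> absorbs the oscillation. Away from \<open>x\<close>, the transform is of size
  \<open>lam ^ (n - 2)\<close> compared with the lower bound for \<open>u\<close>.\<close>
lemma small_spheres:
  fixes u :: "real^'n::finite \<Rightarrow> real"
  assumes n: "CARD('n) \<ge> 3"
    and u: "distr_superharmonic u" "continuous_on UNIV u" "\<And>y. u y > 0"
    and \<delta>: "\<delta> > 0"
  obtains l0 where "l0 > 0"
    "\<And>lam y. 0 < lam \<Longrightarrow> lam \<le> l0 \<Longrightarrow> norm (y - x) \<ge> lam \<Longrightarrow> kelvin u x lam y < (1 + \<delta>) * u y"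
proof -
  define \<nu> where "\<nu> = CARD('n) - 2"
  have \<nu>: "\<nu> \<ge> 1" using n by (simp add: \<nu>_def)
  \<comment> \<open>any \<open>\<eta> < \<delta> / (2 + \<delta>)\<close> satisfies \<open>1 + \<eta> < (1 + \<delta>) * (1 - \<eta>)\<close>\<close>
  define \<eta> where "\<eta> = \<delta> / (2 * (2 + \<delta>))"
  have \<eta>: "\<eta> > 0" "\<eta> < 1"
    using \<delta> by (simp_all add: \<eta>_def field_simps)
  have "\<eta> * (2 + \<delta>) = \<delta> / 2" using \<delta> by (simp add: \<eta>_def field_simps)
  then have \<eta>_less: "1 + \<eta> < (1 + \<delta>) * (1 - \<eta>)" using \<delta> by (simp add: algebra_simps)
  obtain d where d: "d > 0" "\<And>z. dist z x < d \<Longrightarrow> dist (u z) (u x) < \<eta> * u x"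
    using u(2) \<eta>(1) u(3)[of x] unfolding continuous_on_iff by (metis UNIV_I mult_pos_pos)
  define r0 where "r0 = d / 2"
  have r0: "r0 > 0" using d by (simp add: r0_def)
  have near: "(1 - \<eta>) * u x \<le> u z" "u z \<le> (1 + \<eta>) * u x" if "norm (z - x) \<le> r0" for z
    using d(2)[of z] that d(1) by (auto simp: dist_norm r0_def algebra_simps)
  obtain c where c: "c > 0" "\<And>y. norm (y - x) \<ge> r0 \<Longrightarrow> c / norm (y - x) ^ \<nu> \<le> u y"
    using lower_bound_off_centre[OF n u r0] unfolding \<nu>_def by blast
  define l0 where "l0 = min r0 (min 1 (c / (2 * u x)))"
  have l0: "l0 > 0" using r0 c u(3)[of x] by (simp add: l0_def)
  have "kelvin u x lam y < (1 + \<delta>) * u y" if lam: "0 < lam" "lam \<le> l0" and y: "norm (y - x) \<ge> lam" for lam y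
  proof -
    have y_pos: "norm (y - x) > 0" using lam y by linarith
    have "lam * lam \<le> r0 * norm (y - x)" "lam * lam \<le> norm (y - x) * norm (y - x)"
      using lam y by (intro mult_mono; simp add: l0_def)+
    then have refl: "lam\<^sup>2 / norm (y - x) \<le> r0" "lam\<^sup>2 / norm (y - x) \<le> norm (y - x)"
      using y_pos by (simp_all add: divide_le_eq power2_eq_square)
    have K: "kelvin u x lam y \<le> lam ^ \<nu> / norm (y - x) ^ \<nu> * ((1 + \<eta>) * u x)"
      unfolding \<nu>_def by (rule kelvin_le_of_ball_bound[OF lam(1) y_pos refl(1) near(2)])
    show ?thesis
    proof (cases "norm (y - x) \<le> r0")
      case True
      have "lam ^ \<nu> / norm (y - x) ^ \<nu> \<le> 1"
        using power_mono[OF y, of \<nu>] lam y_pos by (simp add: divide_le_eq)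
      then have "lam ^ \<nu> / norm (y - x) ^ \<nu> * ((1 + \<eta>) * u x) \<le> 1 * ((1 + \<eta>) * u x)"
        using \<eta> u(3)[of x] by (intro mult_right_mono) auto
      also have "\<dots> < ((1 + \<delta>) * (1 - \<eta>)) * u x"
        using \<eta>_less u(3)[of x] by simp
      also have "\<dots> \<le> (1 + \<delta>) * u y"
        using near(1)[OF True] \<delta> by simp
      finally show ?thesis using K by linarith
    next
      case False
      have "lam ^ \<nu> \<le> lam ^ 1"
        using lam \<nu> by (intro power_decreasing) (auto simp: l0_def)
      then have "lam ^ \<nu> \<le> c / (2 * u x)" using lam by (simp add: l0_def)
      then have "lam ^ \<nu> * ((1 + \<eta>) * u x) \<le> c / (2 * u x) * (2 * u x)"
        using \<eta> u(3)[of x] c(1) by (intro mult_mono) auto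
      also have "\<dots> = c" using u(3)[of x] by simp
      finally have "lam ^ \<nu> * ((1 + \<eta>) * u x) / norm (y - x) ^ \<nu> \<le> c / norm (y - x) ^ \<nu>"
        by (intro divide_right_mono) auto
      also have "\<dots> \<le> u y" using c(2) False by simp
      also have "\<dots> < (1 + \<delta>) * u y" using \<delta> u(3)[of y] by simp
      finally show ?thesis using K by simp
    qed
  qed
  then show thesis using that l0 by blast
qed

text \<open>Far from \<open>x\<close>, the reflected point is uniformly close to \<open>x\<close> for all radii up to \<open>L\<close>.\<close>
lemma kelvin_far:
  fixes u :: "real^'n::finite \<Rightarrow> real"
  assumes u: "continuous_on UNIV u" and L: "L > 0" and s: "L ^ (CARD('n) - 2) * u x < s" and pos: "\<And>y. u y > 0"
  obtains \<rho> where "\<And>lam y. 0 < lam \<Longrightarrow> lam \<le> L \<Longrightarrow> norm (y - x) \<ge> \<rho> \<Longrightarrow> norm (y - x) ^ (CARD('n) - 2) * kelvin u x lam y < s"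
proof -
  define \<nu> where "\<nu> = CARD('n) - 2"
  define m where "m = s / L ^ \<nu>"
  have m: "u x < m" using s L by (simp add: m_def \<nu>_def field_simps)
  obtain d where d: "d > 0" "\<And>z. dist z x < d \<Longrightarrow> dist (u z) (u x) < (m - u x) / 2"
    using u m unfolding continuous_on_iff by (metis UNIV_I diff_gt_0_iff_gt half_gt_zero)
  have near: "u z \<le> (u x + m) / 2" if "norm (z - x) \<le> d / 2" for z
  proof -
    have "dist z x < d" using that d(1) by (simp add: dist_norm)
    from d(2)[OF this] have "\<bar>u z - u x\<bar> < (m - u x) / 2" by (simp add: dist_real_def)
    then have "u z - u x < (m - u x) / 2" by (rule le_less_trans[OF abs_ge_self])
    then show ?thesis by (simp add: field_simps)
  qed
  have "norm (y - x) ^ \<nu> * kelvin u x lam y < s" if lam: "0 < lam" "lam \<le> L" and y: "norm (y - x) \<ge> 2 * L\<^sup>2 / d" for lam y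
  proof -
    have y_pos: "norm (y - x) > 0" using y L d(1) by (meson divide_pos_pos less_le_trans mult_pos_pos zero_less_numeral zero_less_power)
    have "lam\<^sup>2 \<le> L\<^sup>2" using lam by (intro power_mono) auto
    then have "lam\<^sup>2 / norm (y - x) \<le> d / 2"
      using y y_pos d(1) by (simp add: field_simps)
    from kelvin_le_of_ball_bound[OF lam(1) y_pos this near]
    have "norm (y - x) ^ \<nu> * kelvin u x lam y \<le> lam ^ \<nu> * ((u x + m) / 2)"
      using y_pos by (simp add: \<nu>_def field_simps)
    also have "\<dots> \<le> L ^ \<nu> * ((u x + m) / 2)"
      using lam m pos[of x] by (intro mult_right_mono power_mono) auto
    also have "\<dots> < L ^ \<nu> * m" using m L by simp
    also have "\<dots> = s" using L by (simp add: m_def)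
    finally show ?thesis .
  qed
  then show thesis using that unfolding \<nu>_def by blast
qed

lemma eventually_recentre:
  fixes u :: "real^'n::finite \<Rightarrow> real"
  assumes ev: "\<forall>\<^sub>F y in at_infinity. t < norm y ^ \<nu> * u y" and t: "0 < t" "t' < t"
  shows "\<forall>\<^sub>F y in at_infinity. t' < norm (y - x) ^ \<nu> * u y"
proof -
  have lim0: "((\<lambda>y::real^'n. norm x / norm y) \<longlongrightarrow> 0) at_infinity"
    by (intro tendsto_divide_0[OF tendsto_const] filterlim_at_top_imp_at_infinity filterlim_norm_at_top)
  have "((\<lambda>y::real^'n. norm (y - x) / norm y - 1) \<longlongrightarrow> 0) at_infinity"
  proof (rule Lim_null_comparison[OF _ lim0])
    show "\<forall>\<^sub>F y in at_infinity. norm (norm (y - x) / norm y - 1) \<le> norm x / norm y"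
      unfolding eventually_at_infinity
    proof (intro exI allI impI)
      fix y :: "real^'n" assume "1 \<le> norm y"
      then show "norm (norm (y - x) / norm y - 1) \<le> norm x / norm y"
      proof -
        have "norm (y - x) / norm y - 1 = (norm (y - x) - norm y) / norm y"
          using \<open>1 \<le> norm y\<close> by (auto simp: diff_divide_distrib)
        also have "norm \<dots> = \<bar>norm (y - x) - norm y\<bar> / norm y" by simp
        also have "\<dots> \<le> norm x / norm y"
          using norm_triangle_ineq3[of "y - x" y] by (intro divide_right_mono) auto
        finally show ?thesis .
      qed
    qed
  qed
  then have "((\<lambda>y::real^'n. (norm (y - x) / norm y) ^ \<nu>) \<longlongrightarrow> 1 ^ \<nu>) at_infinity"
    by (intro tendsto_power) (simp add: LIM_zero_iff)
  moreover have "t' / t < 1 ^ \<nu>" using t by (simp add: divide_less_eq)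
  ultimately have "\<forall>\<^sub>F y::real^'n in at_infinity. t' / t < (norm (y - x) / norm y) ^ \<nu>"
    by (rule order_tendstoD)
  moreover have "\<forall>\<^sub>F y::real^'n in at_infinity. norm y \<ge> norm x + 1"
    unfolding eventually_at_infinity by blast
  ultimately show ?thesis using ev
  proof eventually_elim
    case (elim y)
    have "norm y > 0" using elim(2) norm_ge_zero[of x] by linarith
    have "t' < t * (norm (y - x) / norm y) ^ \<nu>"
      using elim(1) t by (simp add: divide_less_eq mult.commute)
    also have "\<dots> \<le> (norm y ^ \<nu> * u y) * (norm (y - x) / norm y) ^ \<nu>"
      using elim(3) by (intro mult_right_mono) auto
    also have "\<dots> = norm (y - x) ^ \<nu> * u y"
      using \<open>norm y > 0\<close> by (simp add: power_divide)
    finally show ?case .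
  qed
qed

lemma continuous_on_kelvin:
  fixes u :: "real^'n::finite \<Rightarrow> real"
  assumes u: "continuous_on UNIV u" and y: "continuous_on S y" and l: "continuous_on S l"
    and ne: "\<And>p. p \<in> S \<Longrightarrow> y p \<noteq> x"
  shows "continuous_on S (\<lambda>p. kelvin u x (l p) (y p))"
  unfolding kelvin_def using ne
  by (intro continuous_intros y l continuous_on_compose2[OF u]) auto

text \<open>If the inequality fails for some radius up to \<open>L\<close>, there is a smallest radius \<open>l\<close> at which
  \<open>(1 + \<delta>) * u\<close> meets its transform: the bounds for small radii and at infinity confine contact
  points to a compact set. At radius \<open>l\<close> the weak inequality still holds, by continuity in the
  radius, and it is strict on both boundary spheres of an annulus, where \<open>kelvin u x l y = u y\<close> on the inner
  one. Hypothesis \<open>touch\<close> then excludes the contact point.\<close>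
lemma moving_spheres:
  fixes u :: "real^'n::finite \<Rightarrow> real"
  assumes n: "CARD('n) \<ge> 3"
    and u: "distr_superharmonic u" "continuous_on UNIV u" "\<And>y. u y > 0"
    and \<delta>: "\<delta> > 0"
    and touch: "\<And>lam \<Omega>. lam > 0 \<Longrightarrow> open \<Omega> \<Longrightarrow> bounded \<Omega> \<Longrightarrow> \<Omega> \<subseteq> {y. norm (y - x) > lam} \<Longrightarrow>
        (\<forall>y\<in>\<Omega>. (1 + \<delta>) * u y \<ge> kelvin u x lam y) \<Longrightarrow>
        (\<forall>y\<in>frontier \<Omega>. (1 + \<delta>) * u y > kelvin u x lam y) \<Longrightarrow>
        (\<forall>y\<in>\<Omega>. (1 + \<delta>) * u y > kelvin u x lam y)"
    and ev: "\<forall>\<^sub>F y in at_infinity. t < norm (y - x) ^ (CARD('n) - 2) * u y"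
    and L: "L > 0" "L ^ (CARD('n) - 2) * u x < t"
    and y1: "norm (y1 - x) \<ge> L"
  shows "kelvin u x L y1 < (1 + \<delta>) * u y1"
proof (rule ccontr)
  assume bad: "\<not> kelvin u x L y1 < (1 + \<delta>) * u y1"
  define \<nu> where "\<nu> = CARD('n) - 2"
  obtain l0 where l0: "l0 > 0"
    and small: "\<And>lam y. 0 < lam \<Longrightarrow> lam \<le> l0 \<Longrightarrow> norm (y - x) \<ge> lam \<Longrightarrow> kelvin u x lam y < (1 + \<delta>) * u y"
    using small_spheres[OF n u \<delta>] by blast
  obtain \<rho>1 where \<rho>1: "\<And>lam y. 0 < lam \<Longrightarrow> lam \<le> L \<Longrightarrow> norm (y - x) \<ge> \<rho>1 \<Longrightarrow> norm (y - x) ^ \<nu> * kelvin u x lam y < t"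
    using kelvin_far[OF u(2) L u(3)] unfolding \<nu>_def by blast
  obtain \<rho>2 where \<rho>2: "\<And>y. norm y \<ge> \<rho>2 \<Longrightarrow> t < norm (y - x) ^ \<nu> * u y"
    using ev unfolding eventually_at_infinity \<nu>_def by blast
  define \<rho> where "\<rho> = max (L + 1) (max \<rho>1 (\<rho>2 + norm x))"
  have far: "kelvin u x lam y < (1 + \<delta>) * u y" if "0 < lam" "lam \<le> L" "norm (y - x) \<ge> \<rho>" for lam y
  proof -
    have "norm y \<ge> norm (y - x) - norm x" using norm_triangle_ineq4[of y x] by simp
    then have "norm (y - x) ^ \<nu> * kelvin u x lam y < norm (y - x) ^ \<nu> * u y"
      using \<rho>1[OF that(1,2), of y] \<rho>2[of y] that(3) by (simp add: \<rho>_def)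
    then have "kelvin u x lam y < u y" by (rule mult_left_less_imp_less) simp
    also have "\<dots> \<le> (1 + \<delta>) * u y" using \<delta> u(3)[of y] by simp
    finally show ?thesis .
  qed
  define S where "S = {p \<in> cbox l0 L \<times> cball x \<rho>. fst p \<le> norm (snd p - x)}"
  have S_closed: "closed S"
    unfolding S_def by (intro continuous_on_closed_Collect_le closed_Times continuous_intros) auto
  moreover have "bounded S"
    by (rule bounded_subset[of "cbox l0 L \<times> cball x \<rho>"]) (auto simp: S_def intro!: bounded_Times)
  ultimately have "compact S" by (simp add: compact_eq_bounded_closed)
  define E where "E = {p \<in> S. (1 + \<delta>) * u (snd p) \<le> kelvin u x (fst p) (snd p)}"
  have E_iff: "(lam, y) \<in> E \<longleftrightarrow> l0 \<le> lam \<and> lam \<le> L \<and> lam \<le> norm (y - x) \<and> norm (y - x) \<le> \<rho> \<and> (1 + \<delta>) * u y \<le> kelvin u x lam y" for lam y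
    by (auto simp: E_def S_def dist_norm norm_minus_commute)
  have "closed E"
    unfolding E_def using l0
    by (intro continuous_on_closed_Collect_le S_closed continuous_intros continuous_on_compose2[OF u(2)] continuous_on_kelvin u(2))
      (auto simp: S_def)
  then have "compact E"
    using compact_Int_closed[OF \<open>compact S\<close>, of E] by (simp add: E_def Int_def conj_commute cong: conj_cong)
  moreover have bad_E: "(lam, y) \<in> E" if "0 < lam" "lam \<le> L" "lam \<le> norm (y - x)" "\<not> kelvin u x lam y < (1 + \<delta>) * u y" for lam y
    using that small[of lam y] far[of lam y] unfolding E_iff by force
  moreover have "E \<noteq> {}" using bad_E[OF L(1) order_refl y1 bad] by blast
  ultimately obtain p0 where p0: "p0 \<in> E" "\<And>p. p \<in> E \<Longrightarrow> fst p0 \<le> fst p"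
    using continuous_attains_inf[of E fst] continuous_on_fst[OF continuous_on_id] by blast
  obtain l y where p0_eq: "p0 = (l, y)" by fastforce
  have ly: "l0 \<le> l" "l \<le> L" "l \<le> norm (y - x)" "norm (y - x) \<le> \<rho>" "(1 + \<delta>) * u y \<le> kelvin u x l y"
    using p0(1) by (simp_all add: p0_eq E_iff)
  have l: "l > 0" using ly l0 by simp
  define \<Omega> where "\<Omega> = {y. l < norm (y - x) \<and> norm (y - x) < \<rho>}"
  have \<Omega>_eq: "\<Omega> = ball x \<rho> - cball x l" by (auto simp: \<Omega>_def dist_norm norm_minus_commute)
  have "\<forall>y\<in>\<Omega>. (1 + \<delta>) * u y > kelvin u x l y"
  proof (rule touch[OF l])
    show \<Omega>_open: "open \<Omega>" unfolding \<Omega>_eq by (intro open_Diff) auto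
    show "bounded \<Omega>" unfolding \<Omega>_eq by (intro bounded_diff bounded_ball)
    show "\<Omega> \<subseteq> {y. l < norm (y - x)}" by (auto simp: \<Omega>_def)
    show "\<forall>y\<in>\<Omega>. kelvin u x l y \<le> (1 + \<delta>) * u y"
    proof
      fix y assume y: "y \<in> \<Omega>"
      then have "y \<noteq> x" using l by (auto simp: \<Omega>_def)
      then have "continuous_on UNIV (\<lambda>lam. kelvin u x lam y)"
        by (intro continuous_on_kelvin u(2) continuous_intros) auto
      then have "((\<lambda>lam. kelvin u x lam y) \<longlongrightarrow> kelvin u x l y) (at_left l)"
        by (auto simp: continuous_on_def intro: tendsto_within_subset)
      moreover have "\<forall>\<^sub>F lam in at_left l. kelvin u x lam y \<le> (1 + \<delta>) * u y"
        using eventually_at_left[OF l]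
      proof (rule iffD2, intro exI[of _ 0] conjI allI impI l)
        fix lam assume lam: "0 < lam" "lam < l"
        then have "(lam, y) \<notin> E" using p0(2) p0_eq by force
        then show "kelvin u x lam y \<le> (1 + \<delta>) * u y"
          using bad_E[of lam y] lam ly y by (force simp: \<Omega>_def)
      qed
      ultimately show "kelvin u x l y \<le> (1 + \<delta>) * u y"
        by (rule tendsto_upperbound) simp
    qed
    show "\<forall>y\<in>frontier \<Omega>. kelvin u x l y < (1 + \<delta>) * u y"
    proof
      fix y assume y: "y \<in> frontier \<Omega>"
      have "closed {y. l \<le> norm (y - x) \<and> norm (y - x) \<le> \<rho>}"
        by (intro closed_Collect_conj closed_Collect_le continuous_intros)
      then have "closure \<Omega> \<subseteq> {y. l \<le> norm (y - x) \<and> norm (y - x) \<le> \<rho>}"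
        by (intro closure_minimal) (auto simp: \<Omega>_def)
      then have "norm (y - x) = l \<or> norm (y - x) = \<rho>"
        using y \<Omega>_open by (auto simp: frontier_def interior_open \<Omega>_def)
      then show "kelvin u x l y < (1 + \<delta>) * u y"
        using far[OF l ly(2), of y] kelvin_on_sphere[OF l, of y x u] \<delta> u(3)[of y] by auto
    qed
  qed
  moreover have "y \<in> \<Omega> \<or> norm (y - x) = l \<or> norm (y - x) = \<rho>"
    using ly by (auto simp: \<Omega>_def)
  ultimately have "kelvin u x l y < (1 + \<delta>) * u y"
    using far[OF l ly(2), of y] kelvin_on_sphere[OF l, of y x u] \<delta> u(3)[of y] by auto
  then show False using ly(5) by simp
qed

section \<open>The Liouville theorem\<close>

text \<open>The spheres reach the radius \<open>L\<close> for every small \<open>\<delta>\<close>; let \<open>\<delta>\<close> tend to \<open>0\<close>.\<close>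
lemma kelvin_le_below_limit:
  fixes u :: "real^'n::finite \<Rightarrow> real"
  assumes n: "CARD('n) \<ge> 3"
    and u: "distr_superharmonic u" "continuous_on UNIV u" "\<And>y. u y > 0"
    and A2: "property_A2 u"
    and ev: "\<forall>\<^sub>F y in at_infinity. t < norm y ^ (CARD('n) - 2) * u y"
    and L: "L > 0" "L ^ (CARD('n) - 2) * u x < t"
    and y: "norm (y - x) \<ge> L"
  shows "kelvin u x L y \<le> u y"
proof -
  obtain \<delta>0 where \<delta>0: "\<delta>0 > 0" and touch: 
    "\<forall>\<delta> x lam \<Omega>. 0 < \<delta> \<longrightarrow> \<delta> < \<delta>0 \<longrightarrow> lam > 0 \<longrightarrow>
        open \<Omega> \<longrightarrow> bounded \<Omega> \<longrightarrow> \<Omega> \<subseteq> {y. norm (y - x) > lam} \<longrightarrow>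
        (\<forall>y\<in>\<Omega>. (1 + \<delta>) * u y \<ge> kelvin u x lam y) \<longrightarrow>
        (\<forall>y\<in>frontier \<Omega>. (1 + \<delta>) * u y > kelvin u x lam y) \<longrightarrow>
        (\<forall>y\<in>\<Omega>. (1 + \<delta>) * u y > kelvin u x lam y)"
    using A2 unfolding property_A2_def by (elim exE conjE) (rule that)
  note touch = touch[THEN spec, THEN spec, THEN spec, THEN spec, THEN mp, THEN mp, THEN mp, THEN mp, THEN mp, THEN mp, THEN mp, THEN mp]
  obtain t' where t': "L ^ (CARD('n) - 2) * u x < t'" "t' < t"
    using dense[OF L(2)] by blast
  have "0 < t" using L u(3)[of x] by (meson less_trans mult_pos_pos zero_less_power)
  from eventually_recentre[OF ev this t'(2)]
  have ev': "\<forall>\<^sub>F y in at_infinity. t' < norm (y - x) ^ (CARD('n) - 2) * u y" .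
  show ?thesis
  proof (rule field_le_epsilon)
    fix e :: real assume e: "e > 0"
    define \<delta> where "\<delta> = min (\<delta>0 / 2) (e / u y)"
    have \<delta>: "0 < \<delta>" "\<delta> < \<delta>0" "\<delta> * u y \<le> e"
      using \<delta>0 e u(3)[of y] by (auto simp: \<delta>_def min_def field_simps)
    have "kelvin u x L y < (1 + \<delta>) * u y"
      by (rule moving_spheres[OF n u \<delta>(1) touch[OF \<delta>(1,2)] ev' L(1) t'(1) y])
    then show "kelvin u x L y \<le> u y + e"
      using \<delta>(3) by (simp add: algebra_simps)
  qed
qed

text \<open>The centre \<open>x = w + R e\<close> on the line from \<open>y\<close> through \<open>w\<close>, with the radius \<open>lam\<close> for which \<open>y\<close> and \<open>w\<close> are
  reflections of each other, gives \<open>u y \<ge> (R / (R + d)) powr ((n - 2) / 2) * u w\<close>. As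
  \<open>R\<close> grows, the spheres flatten to a hyperplane and the factor tends to \<open>1\<close>.\<close>
lemma constant_if_all_kelvin_le:
  fixes u :: "real^'n::finite \<Rightarrow> real"
  assumes "\<And>x lam y. lam > 0 \<Longrightarrow> norm (y - x) \<ge> lam \<Longrightarrow> kelvin u x lam y \<le> u y"
  shows "u w \<le> u y"
proof (cases "y = w")
  case False
  define \<nu> where "\<nu> = CARD('n) - 2"
  define d where "d = norm (w - y)"
  have d: "d > 0" using False by (simp add: d_def)
  define e where "e = (1 / d) *\<^sub>R (w - y)"
  have e: "norm e = 1" "w = y + d *\<^sub>R e" using d by (simp_all add: e_def d_def)
  have "sqrt (R / (R + d)) ^ \<nu> * u w \<le> u y" if R: "R > 0" for R
  proof -
    define x where "x = w + R *\<^sub>R e"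
    have yx: "y - x = (- (R + d)) *\<^sub>R e" by (simp add: x_def e(2) algebra_simps)
    have norm_yx: "norm (y - x) = R + d" using R d e(1) by (simp add: yx)
    define lam where "lam = sqrt (R * (R + d))"
    have lam: "lam > 0" "lam\<^sup>2 = R * (R + d)" using R d by (simp_all add: lam_def)
    have "lam \<le> R + d"
      using R d unfolding lam_def by (intro real_le_lsqrt) (auto simp: power2_eq_square)
    then have "kelvin u x lam y \<le> u y" using assms[OF lam(1)] norm_yx by simp
    moreover have "x + (lam\<^sup>2 / (norm (y - x))\<^sup>2) *\<^sub>R (y - x) = w"
    proof -
      have "R * s / s\<^sup>2 * (- s) = - R" if "s > 0" for s
        using that by (simp add: power2_eq_square)
      then have "lam\<^sup>2 / (R + d)\<^sup>2 * (- (R + d)) = - R"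
        unfolding lam(2) using R d by (meson add_pos_pos)
      then have "(lam\<^sup>2 / (norm (y - x))\<^sup>2) *\<^sub>R (y - x) = (- R) *\<^sub>R e"
        unfolding norm_yx by (simp only: yx scaleR_scaleR)
      then show ?thesis by (simp add: x_def)
    qed
    moreover have "lam / (R + d) = sqrt (R / (R + d))"
    proof -
      have eq: "R / (R + d) = R * (R + d) / (R + d)\<^sup>2" using R d by (simp add: power2_eq_square)
      have "sqrt (R / (R + d)) = sqrt (R * (R + d)) / sqrt ((R + d)\<^sup>2)"
        by (simp only: eq real_sqrt_divide)
      then show ?thesis using R d by (simp add: lam_def)
    qed
    ultimately show ?thesis
      by (simp add: kelvin_def norm_yx \<nu>_def flip: power_divide)
  qed
  then have "\<forall>\<^sub>F R in at_top. sqrt (R / (R + d)) ^ \<nu> * u w \<le> u y"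
    by (rule eventually_mono[OF eventually_gt_at_top[of 0]])
  moreover have "((\<lambda>R. sqrt (R / (R + d)) ^ \<nu> * u w) \<longlongrightarrow> sqrt 1 ^ \<nu> * u w) at_top"
  proof -
    have "((\<lambda>R::real. R / (R + d)) \<longlongrightarrow> 1) at_top"
    proof -
      have "((\<lambda>R::real. 1 - d / (R + d)) \<longlongrightarrow> 1 - 0) at_top"
        by (intro tendsto_diff tendsto_const tendsto_divide_0[OF tendsto_const] filterlim_at_top_imp_at_infinity
            filterlim_at_top_mono[OF filterlim_ident]) (use d in auto)
      moreover have "\<forall>\<^sub>F R in at_top. 1 - d / (R + d) = R / (R + d)"
        using eventually_gt_at_top[of 0] by eventually_elim (use d in \<open>simp add: field_simps\<close>)
      ultimately show ?thesis by (simp add: tendsto_cong)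
    qed
    then show ?thesis by (intro tendsto_intros)
  qed
  ultimately show ?thesis
    using tendsto_upperbound[of "\<lambda>R. sqrt (R / (R + d)) ^ \<nu> * u w" "sqrt 1 ^ \<nu> * u w" at_top "u y"] by simp
qed simp

text \<open>The relation \<open>const\<close> is a first-order equation in disguise: since \<open>lam x ^ \<nu> * u x = \<alpha>\<close>, the
  function \<open>u powr (- 2 / \<nu>)\<close> is \<open>k * (lam x)\<^sup>2\<close> with a constant \<open>k\<close>, and \<open>const\<close> says that its
  gradient is \<open>2 k (x - xbar)\<close>. Hence it is a paraboloid \<open>c + k |x - xbar|\<^sup>2\<close>.\<close>
lemma profile_of_gradient:
  fixes u :: "real^'n::finite \<Rightarrow> real"
  assumes \<nu>: "\<nu> > 0" and \<alpha>: "\<alpha> > 0"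
    and u: "\<And>y. u y > 0"
    and grad: "\<And>x. has_gradient u (v x) x"
    and lam: "\<And>x. lam x > 0" "\<And>x. lam x ^ \<nu> * u x = \<alpha>"
    and const: "\<And>x. lam x ^ \<nu> *\<^sub>R ((real \<nu> * u x) *\<^sub>R x + (lam x)\<^sup>2 *\<^sub>R v x) = V"
  shows "\<exists>xbar a b. a > 0 \<and> b \<ge> 0 \<and> (\<forall>x. u x = (a / (1 + b * (norm (x - xbar))\<^sup>2)) powr (real \<nu> / 2))"
proof -
  define k where "k = \<alpha> powr (- 2 / real \<nu>)"
  have k: "k > 0" using \<alpha> by (simp add: k_def)
  define xbar where "xbar = (1 / (real \<nu> * \<alpha>)) *\<^sub>R V"
  define f where "f x = u x powr (- 2 / real \<nu>)" for x
  have f_lam: "f x = k * (lam x)\<^sup>2" for x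
  proof -
    have "u x = \<alpha> * lam x powr (- real \<nu>)"
      using lam(2)[of x] lam(1)[of x] by (simp add: powr_minus powr_realpow field_simps)
    then have "f x = k * (lam x powr (- real \<nu>)) powr (- 2 / real \<nu>)"
      using \<alpha> lam(1)[of x] by (simp add: f_def k_def powr_mult)
    also have "(lam x powr (- real \<nu>)) powr (- 2 / real \<nu>) = lam x powr 2"
      using \<nu> by (subst powr_powr) simp
    finally show ?thesis using lam(1)[of x] by (simp add: powr_realpow[of _ 2, simplified])
  qed
  have v_eq: "((lam x)\<^sup>2 / u x) *\<^sub>R v x = real \<nu> *\<^sub>R (xbar - x)" for x
  proof -
    have "V = (real \<nu> * \<alpha>) *\<^sub>R x + (\<alpha> / u x * (lam x)\<^sup>2) *\<^sub>R v x"
    proof -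
      have pow: "lam x ^ \<nu> = \<alpha> / u x" using lam(2)[of x] u[of x] by (simp add: eq_divide_eq)
      have "V = (\<alpha> / u x * (real \<nu> * u x)) *\<^sub>R x + (\<alpha> / u x * (lam x)\<^sup>2) *\<^sub>R v x"
        using const[of x] unfolding pow by (simp only: scaleR_right_distrib scaleR_scaleR)
      moreover have "\<alpha> / u x * (real \<nu> * u x) = real \<nu> * \<alpha>" using u[of x] by simp
      ultimately show ?thesis by simp
    qed
    then have "xbar = x + (1 / (real \<nu> * \<alpha>) * (\<alpha> / u x * (lam x)\<^sup>2)) *\<^sub>R v x"
      unfolding xbar_def using \<nu> \<alpha> by (simp add: scaleR_right_distrib)
    then have "real \<nu> *\<^sub>R (xbar - x) = (real \<nu> * (1 / (real \<nu> * \<alpha>) * (\<alpha> / u x * (lam x)\<^sup>2))) *\<^sub>R v x"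
      by simp
    also have "real \<nu> * (1 / (real \<nu> * \<alpha>) * (\<alpha> / u x * (lam x)\<^sup>2)) = (lam x)\<^sup>2 / u x"
      using \<nu> \<alpha> by simp
    finally show ?thesis by simp
  qed
  have f_grad: "has_gradient f ((2 * k) *\<^sub>R (x - xbar)) x" for x
  proof -
    have "((\<lambda>t. t powr (- 2 / real \<nu>)) has_real_derivative (- 2 / real \<nu>) * u x powr (- 2 / real \<nu> - 1)) (at (u x))"
      using u[of x] by (auto intro!: derivative_eq_intros)
    from has_gradient_compose[OF this grad]
    have "has_gradient f (((- 2 / real \<nu>) * u x powr (- 2 / real \<nu> - 1)) *\<^sub>R v x) x"
      unfolding f_def .
    also have "(- 2 / real \<nu>) * u x powr (- 2 / real \<nu> - 1) = (- 2 / real \<nu>) * k * ((lam x)\<^sup>2 / u x)"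
      using u[of x] f_lam[of x] by (simp add: powr_diff f_def)
    also have "\<dots> *\<^sub>R v x = ((- 2 / real \<nu>) * k) *\<^sub>R (real \<nu> *\<^sub>R (xbar - x))"
      unfolding v_eq[symmetric] by simp
    also have "\<dots> = (2 * k) *\<^sub>R (x - xbar)"
      using \<nu> by (simp add: algebra_simps)
    finally show ?thesis .
  qed
  define g where "g x = f x + (- k) * (norm (x - xbar))\<^sup>2" for x
  have "has_gradient g ((2 * k) *\<^sub>R (x - xbar) + ((- k) *\<^sub>R (2 *\<^sub>R (x - xbar)) + (norm (x - xbar))\<^sup>2 *\<^sub>R 0)) x" for x
    unfolding g_def by (intro has_gradient_add has_gradient_mult has_gradient_const f_grad has_gradient_norm_square)
  then have "(g has_derivative (\<lambda>h. 0)) (at x)" for x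
    by (simp add: has_gradient_def mult.commute inner_zero_left[abs_def])
  then obtain c where c: "\<And>x. g x = c"
    using has_derivative_zero_constant[of UNIV g] by auto
  have f_eq: "f x = c + k * (norm (x - xbar))\<^sup>2" for x
    using c[of x] by (simp add: g_def)
  have c_pos: "c > 0"
    using f_eq[of xbar] u[of xbar] by (simp add: f_def) (metis powr_gt_zero less_irrefl)
  have "u x = (1 / c / (1 + k / c * (norm (x - xbar))\<^sup>2)) powr (real \<nu> / 2)" for x
  proof -
    have "f x > 0" using u[of x] by (simp add: f_def)
    have "u x = f x powr (- real \<nu> / 2)"
      using u[of x] \<nu> by (simp add: f_def powr_powr)
    also have "\<dots> = (1 / f x) powr (real \<nu> / 2)"
      using \<open>f x > 0\<close> by (simp add: powr_minus powr_divide inverse_eq_divide)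
    also have "1 / f x = 1 / c / (1 + k / c * (norm (x - xbar))\<^sup>2)"
      using c_pos by (simp add: f_eq field_simps)
    finally show ?thesis .
  qed
  moreover have "1 / c > 0" "k / c \<ge> 0" using c_pos k by auto
  ultimately show ?thesis by blast
qed

theorem theorem1p1:
  fixes u :: "real^'n::finite \<Rightarrow> real"
  assumes "CARD('n) \<ge> 3"
    and "u \<in> class_A"
  shows "\<exists>(xbar :: real^'n) (a :: real) (b :: real). a > 0 \<and> b \<ge> 0 \<and>
    (\<forall>x. u x = (a / (1 + b * (norm (x - xbar))\<^sup>2)) powr ((real CARD('n) - 2) / 2))"
proof -
  define \<nu> where "\<nu> = CARD('n) - 2"
  have \<nu>: "\<nu> > 0" "real CARD('n) - 2 = real \<nu>" using assms(1) by (auto simp: \<nu>_def)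
  have A1: "property_A1 u" and A2: "property_A2 u" using assms(2) by (auto simp: class_A_def)
  have diff: "u differentiable (at x)" for x
    using A1 by (simp add: property_A1_def differentiable_on_def)
  have u: "distr_superharmonic u" "continuous_on UNIV u" "\<And>y. u y > 0"
    using A1 diff by (auto simp: property_A1_def
        intro!: continuous_at_imp_continuous_on differentiable_imp_continuous_within)
  \<comment> \<open>the supremum of \<open>T\<close>, infinite if \<open>T\<close> is unbounded, is the lower limit of \<open>|y| ^ \<nu> * u y\<close>\<close>
  define T where "T = {t. \<forall>\<^sub>F y in at_infinity. t < norm y ^ \<nu> * u y}"
  have kelvin_le: "kelvin u x L y \<le> u y" if "t \<in> T" "L > 0" "L ^ \<nu> * u x < t" "norm (y - x) \<ge> L" for t x L y
    using kelvin_le_below_limit[OF assms(1) u A2 _ that(2) _ that(4)] that(1,3) by (simp add: T_def \<nu>_def)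
  obtain c where c: "c > 0" "\<And>y. norm y \<ge> 1 \<Longrightarrow> c / norm y ^ \<nu> \<le> u y"
    using superharmonic_lower_bound[OF assms(1) u] unfolding \<nu>_def by blast
  have T_pos: "c / 2 \<in> T"
    unfolding T_def mem_Collect_eq eventually_at_infinity
  proof (intro exI allI impI)
    fix y :: "real^'n" assume y: "1 \<le> norm y"
    then have "norm y ^ \<nu> > 0" by (intro zero_less_power) linarith
    then have "c \<le> norm y ^ \<nu> * u y" using c(2)[OF y] by (simp add: divide_le_eq mult.commute)
    then show "c / 2 < norm y ^ \<nu> * u y" using c(1) by linarith
  qed
  show ?thesis
  proof (cases "bdd_above T")
    case False
    have "kelvin u x L y \<le> u y" if L: "L > 0" "norm (y - x) \<ge> L" for x L y
    proof -
      obtain t where "t \<in> T" "L ^ \<nu> * u x < t"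
        using False unfolding bdd_above_def by (meson not_le)
      then show ?thesis using kelvin_le L by blast
    qed
    then have "u x = u 0" for x
      using constant_if_all_kelvin_le[of u] by (metis order_antisym)
    moreover have "u 0 = ((u 0 powr (2 / real \<nu>)) / (1 + 0 * (norm (x - 0))\<^sup>2)) powr (real \<nu> / 2)" for x :: "real^'n"
      using \<nu>(1) u(3)[of 0] by (simp add: powr_powr)
    moreover have "u 0 powr (2 / real \<nu>) > 0" using u(3)[of 0] by simp
    ultimately show ?thesis unfolding \<nu>(2) by (metis order_refl)
  next
    case True
    define \<alpha> where "\<alpha> = Sup T"
    have \<alpha>_ge: "t \<le> \<alpha>" if "t \<in> T" for t
      unfolding \<alpha>_def using that True by (rule cSup_upper)
    have \<alpha>: "\<alpha> > 0" using \<alpha>_ge[OF T_pos] c(1) by simp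
    \<comment> \<open>the critical radius, for which \<open>|y| ^ \<nu>\<close> times the transform tends to \<open>\<alpha>\<close> at infinity\<close>
    define lam where "lam x = root \<nu> (\<alpha> / u x)" for x
    have lam: "lam x > 0" "lam x ^ \<nu> * u x = \<alpha>" for x
      using \<nu>(1) \<alpha> u(3)[of x] by (auto simp: lam_def real_root_pow_pos2)
    have crit: "kelvin u x (lam x) y \<le> u y" if y: "norm (y - x) \<ge> lam x" for x y
    proof (rule tendsto_upperbound)
      have "y \<noteq> x" using y lam(1)[of x] by auto
      then have "continuous_on UNIV (\<lambda>l. kelvin u x l y)"
        by (intro continuous_on_kelvin u(2) continuous_intros) auto
      then show "((\<lambda>l. kelvin u x l y) \<longlongrightarrow> kelvin u x (lam x) y) (at_left (lam x))"
        by (auto simp: continuous_on_def intro: tendsto_within_subset)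
      show "\<forall>\<^sub>F l in at_left (lam x). kelvin u x l y \<le> u y"
        using eventually_at_left[OF lam(1)[of x]]
      proof (rule iffD2, intro exI[of _ 0] conjI allI impI lam(1))
        fix l assume l: "0 < l" "l < lam x"
        have "l ^ \<nu> < lam x ^ \<nu>" using l \<nu>(1) by (intro power_strict_mono) auto
        then have "l ^ \<nu> * u x < \<alpha>" using lam(2)[of x] u(3)[of x] by (metis mult_less_cancel_right_pos)
        then obtain t where "t \<in> T" "l ^ \<nu> * u x < t"
          unfolding \<alpha>_def using less_cSup_iff[OF _ True] T_pos by auto
        then show "kelvin u x l y \<le> u y" using kelvin_le l y by auto
      qed
    qed simp
    define v where "v x = (\<chi> i. partial_derivative i u x)" for x
    have grad: "has_gradient u (v x) x" for x
      unfolding v_def by (rule has_gradient_partials[OF diff])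
    define G where "G x = lam x ^ \<nu> *\<^sub>R ((real \<nu> * u x) *\<^sub>R x + (lam x)\<^sup>2 *\<^sub>R v x)" for x
    have expansion: "\<forall>\<^sub>F y in at_infinity. \<alpha> + (G x \<bullet> y) / (norm y)\<^sup>2 - \<epsilon> / norm y \<le> norm y ^ \<nu> * u y"
      if "\<epsilon> > 0" for x \<epsilon>
    proof -
      have "\<forall>\<^sub>F y::real^'n in at_infinity. norm y \<ge> lam x + norm x"
        unfolding eventually_at_infinity by blast
      with kelvin_expansion[OF grad[of x] that, of "lam x"] show ?thesis
      proof eventually_elim
        case (elim y)
        have "norm (y - x) \<ge> lam x" using elim(2) norm_triangle_ineq2[of y x] by linarith
        then have "norm y ^ \<nu> * kelvin u x (lam x) y \<le> norm y ^ \<nu> * u y"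
          by (intro mult_left_mono crit) auto
        with elim(1) show ?case by (simp add: G_def lam(2) \<nu>_def[symmetric])
      qed
    qed
    have "G x = G 0" for x
    proof (rule ccontr)
      assume "G x \<noteq> G 0"
      then obtain t where "t > \<alpha>" "t \<in> T"
        using distinct_gradients_raise_limit[OF assms(1) u expansion[unfolded \<nu>_def] expansion[unfolded \<nu>_def]] 
        unfolding T_def \<nu>_def by blast
      then show False using \<alpha>_ge by force
    qed
    then show ?thesis
      unfolding \<nu>(2) by (intro profile_of_gradient[OF \<nu>(1) \<alpha> u(3) grad lam, of "G 0"]) (simp add: G_def)
  qed
qed

end
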